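(* Let $p(a,x)=r(x)a+ar(x)-2f(x)$, where $a$ and $x$ are freely noncommuting symmetric variables (one of each) and $r$ and $f$ are scalar real polynomials in the single variable $x$ of degree $k$ and $d$ respectively, such that: (i) $r(0)=1$ and $f(0)=0$; (ii) $fr^{-1}$ is not constant; (iii) there exists an $\epsilon>0$ such that for each positive integer $n$ and each $A\in\mathbb{S}_n$ the set $$\{X\in\mathbb{S}_n:\ p(A,X)\succ0\ \text{and}\ \|X\|<\epsilon\}$$ is convex. Then there exist a symmetric free polynomial $\ell$ (in $a$ and $x$) that is affine linear in $x$ and finitely many free polynomials $s_1,\dots,s_n$, each linear (hence homogeneous) in $x$ and independent of $a$, such that $$p(a,x)=\ell(a,x)-\sum_{j=1}^n s_j(x)^Ts_j(x).$$ In particular, $d$ is at most two.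
   Context: A free polynomial in $(a,x)$ is a finite real linear combination of words in the noncommuting letters $a,x$; the involution $T$ reverses words ($a^T=a$, $x^T=x$), and a polynomial $q$ is symmetric if $q=q^T$. $\mathbb{S}_n$ is the set of real symmetric $n\times n$ matrices; $p(A,X)$ denotes evaluation at $A,X\in\mathbb{S}_n$. $M\succ0$ means $M$ is positive definite; $\|\cdot\|$ is the operator norm. Affine linear in $x$ means of degree at most one in $x$. *)

theory Defs
  imports
    "Jordan_Normal_Form.Matrix"
    "HOL-Library.Poly_Mapping"
    "HOL-Computational_Algebra.Polynomial"
    "HOL-Computational_Algebra.Fraction_Field"
begin

section \<open>Free polynomials in two symmetric letters\<close>

datatype letter = LetA | LetX

text \<open>Words are wrapped in their own type because the monoid structure below (concatenation) differs
  from the pointwise one that HOL-Library puts on lists.\<close>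

datatype word = Word (letters: "letter list")

instantiation word :: monoid_add
begin

definition zero_word :: word where
  "0 = Word []"

definition plus_word :: "word \<Rightarrow> word \<Rightarrow> word" where
  "u + v = Word (letters u @ letters v)"

instance
  by standard (simp_all add: zero_word_def plus_word_def)

end

text \<open>The monoid algebra of the free monoid: multiplication of finitely supported functions is
  convolution along concatenation, so it is not commutative.\<close>

type_synonym free_poly = "word \<Rightarrow>\<^sub>0 real"

definition fconst :: "real \<Rightarrow> free_poly" where
  "fconst c = Poly_Mapping.single 0 c"

definition fa :: free_poly where
  "fa = Poly_Mapping.single (Word [LetA]) 1"

definition fx :: free_poly where
  "fx = Poly_Mapping.single (Word [LetX]) 1"

definition at_fx :: "real poly \<Rightarrow> free_poly" where
  "at_fx q = (\<Sum>i\<le>degree q. fconst (coeff q i) * fx ^ i)"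

definition rev_word :: "word \<Rightarrow> word" where
  "rev_word w = Word (rev (letters w))"

lemma rev_word_rev_word [simp]: "rev_word (rev_word w) = w"
  by (simp add: rev_word_def)

lemma inj_rev_word: "inj rev_word"
  by (rule injI) (metis rev_word_rev_word)

text \<open>\<open>map_key\<close> precomposes the coefficient function with \<open>rev_word\<close>; since reversal is its own
  inverse, this sends each word to its reversal.\<close>

definition fstar :: "free_poly \<Rightarrow> free_poly" where
  "fstar q = Poly_Mapping.map_key rev_word q"

lemma lookup_fstar: "Poly_Mapping.lookup (fstar q) w = Poly_Mapping.lookup q (rev_word w)"
  by (simp add: fstar_def map_key.rep_eq[OF inj_rev_word])

lemma fstar_single: "fstar (Poly_Mapping.single w c) = Poly_Mapping.single (rev_word w) c"
  using map_key_single[OF inj_rev_word, of "rev_word w" c] by (simp add: fstar_def)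

definition symmetric_poly :: "free_poly \<Rightarrow> bool" where
  "symmetric_poly q \<longleftrightarrow> fstar q = q"

definition x_deg :: "word \<Rightarrow> nat" where
  "x_deg w = count_list (letters w) LetX"

definition affine_linear_in_x :: "free_poly \<Rightarrow> bool" where
  "affine_linear_in_x q \<longleftrightarrow> (\<forall>w \<in> Poly_Mapping.keys q. x_deg w \<le> 1)"

definition linear_in_x :: "free_poly \<Rightarrow> bool" where
  "linear_in_x q \<longleftrightarrow> (\<forall>w \<in> Poly_Mapping.keys q. x_deg w = 1)"

definition independent_of_a :: "free_poly \<Rightarrow> bool" where
  "independent_of_a q \<longleftrightarrow> (\<forall>w \<in> Poly_Mapping.keys q. LetA \<notin> set (letters w))"


section \<open>Real symmetric matrices and evaluation\<close>

definition sym_mats :: "nat \<Rightarrow> real mat set" where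
  "sym_mats n = {M \<in> carrier_mat n n. transpose_mat M = M}"

definition pos_def :: "real mat \<Rightarrow> bool" where
  "pos_def M \<longleftrightarrow> M \<in> sym_mats (dim_row M) \<and>
     (\<forall>v \<in> carrier_vec (dim_row M). v \<noteq> 0\<^sub>v (dim_row M) \<longrightarrow> v \<bullet> (M *\<^sub>v v) > 0)"

definition op_norm :: "real mat \<Rightarrow> real" where
  "op_norm M = (SUP v \<in> {v \<in> carrier_vec (dim_col M). sqrt (v \<bullet> v) \<le> 1}.
     sqrt ((M *\<^sub>v v) \<bullet> (M *\<^sub>v v)))"

text \<open>Matrices with explicit dimensions do not form a \<open>real_vector\<close> type, so the library's
  \<open>convex\<close> does not apply to them.\<close>

definition convex_mats :: "real mat set \<Rightarrow> bool" where
  "convex_mats S \<longleftrightarrow> (\<forall>X \<in> S. \<forall>Y \<in> S. \<forall>u \<ge> 0. \<forall>v \<ge> 0. u + v = 1 \<longrightarrow>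
     u \<cdot>\<^sub>m X + v \<cdot>\<^sub>m Y \<in> S)"

fun eval_letter :: "real mat \<Rightarrow> real mat \<Rightarrow> letter \<Rightarrow> real mat" where
  "eval_letter A X LetA = A"
| "eval_letter A X LetX = X"

definition eval_word :: "nat \<Rightarrow> real mat \<Rightarrow> real mat \<Rightarrow> word \<Rightarrow> real mat" where
  "eval_word n A X w = foldr (\<lambda>l M. eval_letter A X l * M) (letters w) (1\<^sub>m n)"

text \<open>The linear combination of the words is formed entrywise, because \<open>sum\<close> is not available on
  matrices with explicit dimensions.\<close>

definition eval_free :: "nat \<Rightarrow> real mat \<Rightarrow> real mat \<Rightarrow> free_poly \<Rightarrow> real mat" where
  "eval_free n A X q = mat n n (\<lambda>(i, j).
     \<Sum>w \<in> Poly_Mapping.keys q. Poly_Mapping.lookup q w * eval_word n A X w $$ (i, j))"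

end

theory Submission
  imports Defs "HOL-Analysis.Convex"
begin

text \<open>
  If \<open>r = 1 + r1 x\<close> and \<open>f = f1 x + f2 x\<^sup>2\<close> with \<open>f2 \<ge> 0\<close>, then \<open>p + 2 f2 x\<^sup>2\<close> is affine linear in \<open>x\<close> and the single
  square with \<open>s = sqrt (2 f2) x\<close> gives the decomposition. The work is to show that convexity forces this shape.

  Convexity is tested at \<open>X = [[D, t h], [t h\<^sup>T, 0]]\<close> with \<open>D\<close> diagonal with small entries \<open>x i\<close>, against a weight \<open>A\<close> with
  diagonal blocks \<open>B\<close> and \<open>b\<close>. The matrix \<open>B\<close> can be chosen so that \<open>r(D) B + B r(D) - 2 f(D)\<close> is any prescribed symmetric
  matrix, in particular a positive semidefinite one with kernel spanned by a prescribed vector \<open>v\<close>. Then \<open>p(A, X)\<close> is degenerate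
  at \<open>t = 0\<close>, the midpoint of a segment with conjugate endpoints \<open>t\<close> and \<open>-t\<close>; so it cannot be positive definite for small
  \<open>t \<noteq> 0\<close>. Expanding to second order in \<open>t\<close> and taking a Schur complement, this says \<open>K * 2 b \<le> e\<^sup>2\<close> (\<open>curvature_test\<close>), where, with
  \<open>y = B v\<close> and with divided differences \<open>r[x, 0, x']\<close> and \<open>f[x, 0, x']\<close>,

    \<open>K = 2 \<Sum> v_i h_i r[x_i, 0, x_j] h_j y_j - 2 \<Sum> v_i h_i f[x_i, 0, x_j] h_j v_j\<close>

  and \<open>e\<close> is a sum of terms linear in \<open>h\<close> that involve \<open>r[x_i, 0]\<close> and \<open>f[x_i, 0]\<close>. Coordinates outside the support of \<open>v\<close> at which
  \<open>y\<close> does not vanish let one change \<open>K\<close> and \<open>e\<close> at will (\<open>curvature_inequality\<close>).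

  Two such coordinates contradict the inequality as soon as \<open>r\<close> has degree at least 2, because \<open>r[0, 0, x]\<close> and \<open>r[x, 0]\<close> are then
  linearly independent polynomials in \<open>x\<close> (\<open>degree_r_le_1\<close>). For \<open>r\<close> of degree at most 1 the first sum in \<open>K\<close> vanishes, and
  making \<open>e\<close> irrelevant shows that the kernel \<open>f[x, 0, x']\<close> is positive semidefinite on arbitrarily many points
  (\<open>curvature_kernel_psd\<close>). This kernel is the Hankel form of the coefficients \<open>f_(a+b+2)\<close>, and a semidefinite Hankel form with finitely
  many nonzero entries vanishes except in its first entry; thus \<open>f\<close> has degree at most 2 and \<open>f2 \<ge> 0\<close>
  (\<open>degree_le_2_if_kernels_psd\<close>, \<open>coeff_2_nonneg_if_kernel_psd\<close>).
\<close>

section \<open>Evaluating the pencil\<close>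

text \<open>The values of a polynomial \<open>q\<close> at a number, at an entry of a matrix, and all of its divided differences are
one linear functional each: they replace the monomial \<open>x ^ m\<close> by a weight \<open>w m\<close>. Working with the weights
lets every identity below be proved for powers alone.\<close>

definition pair_coeffs :: "real poly \<Rightarrow> (nat \<Rightarrow> real) \<Rightarrow> real" where
  "pair_coeffs q w = (\<Sum>m\<le>degree q. coeff q m * w m)"

text \<open>A fixed matrix entry of \<open>eval_free\<close> is the linear extension of a function on words. Viewed this way, additivity
does not have to be argued about matrices.\<close>

definition weigh_words :: "(word \<Rightarrow> real) \<Rightarrow> free_poly \<Rightarrow> real" where
  "weigh_words W q = (\<Sum>w\<in>Poly_Mapping.keys q. Poly_Mapping.lookup q w * W w)"

lemma weigh_words_superset:
  assumes "finite S" "Poly_Mapping.keys q \<subseteq> S"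
  shows "weigh_words W q = (\<Sum>w\<in>S. Poly_Mapping.lookup q w * W w)"
  unfolding weigh_words_def
  by (rule sum.mono_neutral_left) (use assms in \<open>auto simp: in_keys_iff\<close>)

lemma weigh_words_add: "weigh_words W (p + q) = weigh_words W p + weigh_words W q"
proof -
  let ?S = "Poly_Mapping.keys p \<union> Poly_Mapping.keys q"
  have "weigh_words W (p + q) = (\<Sum>w\<in>?S. Poly_Mapping.lookup (p + q) w * W w)"
    by (rule weigh_words_superset) (auto dest: subsetD[OF keys_add])
  moreover have "weigh_words W p = (\<Sum>w\<in>?S. Poly_Mapping.lookup p w * W w)"
    "weigh_words W q = (\<Sum>w\<in>?S. Poly_Mapping.lookup q w * W w)"
    by (rule weigh_words_superset; auto)+
  ultimately show ?thesis
    by (simp add: lookup_add distrib_right sum.distrib)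
qed

lemma weigh_words_0 [simp]: "weigh_words W 0 = 0"
  by (simp add: weigh_words_def)

lemma weigh_words_diff: "weigh_words W (p - q) = weigh_words W p - weigh_words W q"
  using weigh_words_add[of W "p - q" q] by simp

lemma weigh_words_sum: "weigh_words W (\<Sum>i\<in>I. g i) = (\<Sum>i\<in>I. weigh_words W (g i))"
  by (induction I rule: infinite_finite_induct) (auto simp: weigh_words_add)

lemma weigh_words_single [simp]: "weigh_words W (Poly_Mapping.single w c) = c * W w"
  by (cases "c = 0") (auto simp: weigh_words_def)

abbreviation x_power :: "nat \<Rightarrow> word" where
  "x_power m \<equiv> Word (replicate m LetX)"

lemma fx_power: "fx ^ m = Poly_Mapping.single (x_power m) 1"
proof (induction m)
  case 0
  then show ?case by (simp flip: zero_word_def)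
next
  case (Suc m)
  then show ?case by (simp add: fx_def mult_single plus_word_def)
qed

lemma at_fx_eq: "at_fx q = (\<Sum>m\<le>degree q. Poly_Mapping.single (x_power m) (coeff q m))"
  by (simp add: at_fx_def fx_power fconst_def mult_single)

lemma weigh_words_at_fx_fa:
  "weigh_words W (at_fx q * fa) = pair_coeffs q (\<lambda>m. W (x_power m + Word [LetA]))"
  by (simp add: at_fx_eq weigh_words_sum pair_coeffs_def fa_def sum_distrib_right mult_single)

lemma weigh_words_fa_at_fx:
  "weigh_words W (fa * at_fx q) = pair_coeffs q (\<lambda>m. W (Word [LetA] + x_power m))"
  by (simp add: at_fx_eq weigh_words_sum pair_coeffs_def fa_def sum_distrib_left mult_single)

lemma weigh_words_scaled_at_fx:
  "weigh_words W (fconst c * at_fx q) = c * pair_coeffs q (\<lambda>m. W (x_power m))"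
  by (simp add: at_fx_eq weigh_words_sum pair_coeffs_def fconst_def sum_distrib_left mult_single
      mult.assoc)

text \<open>\<open>eval_word\<close> multiplies from the left and \<open>pow_mat\<close> from the right.\<close>

lemma pow_mat_commute:
  assumes "(X :: real mat) \<in> carrier_mat n n"
  shows "X * X ^\<^sub>m m = X ^\<^sub>m m * X"
proof (induction m)
  case 0
  then show ?case using assms by simp
next
  case (Suc m)
  have "X * (X ^\<^sub>m m * X) = (X * X ^\<^sub>m m) * X"
    using assms by (simp add: assoc_mult_mat[of _ n n _ n _ n])
  then show ?case by (simp add: Suc)
qed

lemma eval_word_x_power:
  assumes "X \<in> carrier_mat n n"
  shows "eval_word n A X (x_power m) = X ^\<^sub>m m"
proof (induction m)
  case (Suc m)
  then show ?case using pow_mat_commute[OF assms, of m] by (simp add: eval_word_def)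
qed (use assms in \<open>simp add: eval_word_def\<close>)

lemma eval_word_x_power_a:
  assumes "A \<in> carrier_mat n n" "X \<in> carrier_mat n n"
  shows "eval_word n A X (x_power m + Word [LetA]) = X ^\<^sub>m m * A"
proof (induction m)
  case (Suc m)
  have "X * (X ^\<^sub>m m * A) = (X * X ^\<^sub>m m) * A"
    using assms by (simp add: assoc_mult_mat[of _ n n _ n _ n])
  then show ?case 
    using Suc pow_mat_commute[OF assms(2), of m] by (simp add: eval_word_def plus_word_def)
qed (use assms in \<open>simp add: eval_word_def plus_word_def\<close>)

lemma eval_word_a_x_power:
  assumes "A \<in> carrier_mat n n" "X \<in> carrier_mat n n"
  shows "eval_word n A X (Word [LetA] + x_power m) = A * X ^\<^sub>m m"
  using eval_word_x_power[OF assms(2), of A m] by (simp add: eval_word_def plus_word_def)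

definition poly_entry :: "real poly \<Rightarrow> real mat \<Rightarrow> nat \<Rightarrow> nat \<Rightarrow> real" where
  "poly_entry q X i j = pair_coeffs q (\<lambda>m. (X ^\<^sub>m m) $$ (i, j))"

definition pencil :: "real poly \<Rightarrow> real poly \<Rightarrow> free_poly" where
  "pencil r f = at_fx r * fa + fa * at_fx r - fconst 2 * at_fx f"

lemma mat_mult_entry:
  assumes "M \<in> carrier_mat n n" "M' \<in> carrier_mat n n" "i < n" "j < n"
  shows "(M * M') $$ (i, j) = (\<Sum>l<n. M $$ (i, l) * (M' $$ (l, j) :: real))"
  using assms by (simp add: scalar_prod_def atLeast0LessThan)

lemma eval_pencil_entry:
  assumes A: "A \<in> carrier_mat n n" and X: "X \<in> carrier_mat n n" and "i < n" "j < n"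
  shows "eval_free n A X (pencil r f) $$ (i, j) =
    (\<Sum>l<n. poly_entry r X i l * A $$ (l, j)) + (\<Sum>l<n. A $$ (i, l) * poly_entry r X l j)
      - 2 * poly_entry f X i j"
proof -
  let ?W = "\<lambda>w. eval_word n A X w $$ (i, j)"
  have "eval_free n A X q $$ (i, j) = weigh_words ?W q" for q
    using assms by (simp add: eval_free_def weigh_words_def)
  moreover have "pair_coeffs r (\<lambda>m. (X ^\<^sub>m m * A) $$ (i, j)) = (\<Sum>l<n. poly_entry r X i l * A $$ (l, j))"
    using assms
    by (simp add: mat_mult_entry[of _ n] pair_coeffs_def poly_entry_def sum_distrib_left sum_distrib_right
        mult.assoc del: index_mult_mat) (rule sum.swap)
  moreover have "pair_coeffs r (\<lambda>m. (A * X ^\<^sub>m m) $$ (i, j)) = (\<Sum>l<n. A $$ (i, l) * poly_entry r X l j)"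
    using assms
    by (simp add: mat_mult_entry[of _ n] pair_coeffs_def poly_entry_def sum_distrib_left sum_distrib_right
        mult.left_commute del: index_mult_mat) (rule sum.swap)
  ultimately show ?thesis
    using A X
    by (simp add: pencil_def weigh_words_add weigh_words_diff weigh_words_at_fx_fa weigh_words_fa_at_fx
        weigh_words_scaled_at_fx eval_word_x_power eval_word_x_power_a eval_word_a_x_power poly_entry_def)
qed

lemma eval_free_carrier: "eval_free n A X q \<in> carrier_mat n n"
  by (simp add: eval_free_def)

lemma pow_mat_symmetric:
  assumes "X \<in> sym_mats n"
  shows "transpose_mat (X ^\<^sub>m m) = X ^\<^sub>m m"
proof (induction m)
  case (Suc m)
  have X: "X \<in> carrier_mat n n" "transpose_mat X = X"
    using assms by (auto simp: sym_mats_def)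
  have "transpose_mat (X ^\<^sub>m m * X) = transpose_mat X * transpose_mat (X ^\<^sub>m m)"
    by (rule transpose_mult[of _ n n _ n]) (use X in auto)
  then show ?case using X Suc pow_mat_commute[OF X(1), of m] by simp
qed simp

lemma symmetric_entry:
  assumes "transpose_mat M = M" "M \<in> carrier_mat n n" "i < n" "j < n"
  shows "M $$ (i, j) = M $$ (j, i)"
  using assms by (metis carrier_matD(1) carrier_matD(2) index_transpose_mat(1))

lemma poly_entry_symmetric:
  assumes "X \<in> sym_mats n" "i < n" "j < n"
  shows "poly_entry q X i j = poly_entry q X j i"
proof -
  have "(X ^\<^sub>m m) $$ (i, j) = (X ^\<^sub>m m) $$ (j, i)" for m
    by (rule symmetric_entry[OF pow_mat_symmetric]) (use assms in \<open>auto simp: sym_mats_def\<close>)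
  then show ?thesis by (simp add: poly_entry_def)
qed

lemma eval_pencil_symmetric:
  assumes A: "A \<in> sym_mats n" and X: "X \<in> sym_mats n"
  shows "eval_free n A X (pencil r f) \<in> sym_mats n"
proof -
  let ?P = "eval_free n A X (pencil r f)"
  have c: "A \<in> carrier_mat n n" "X \<in> carrier_mat n n"
    using assms by (auto simp: sym_mats_def)
  have "?P $$ (j, i) = ?P $$ (i, j)" if ij: "i < n" "j < n" for i j
  proof -
    have a: "A $$ (k, l) = A $$ (l, k)" if "k < n" "l < n" for k l
      by (rule symmetric_entry[of _ n]) (use A that in \<open>auto simp: sym_mats_def\<close>)
    have "(\<Sum>l<n. poly_entry r X j l * A $$ (l, i)) = (\<Sum>l<n. A $$ (i, l) * poly_entry r X l j)"
      "(\<Sum>l<n. A $$ (j, l) * poly_entry r X l i) = (\<Sum>l<n. poly_entry r X i l * A $$ (l, j))"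
      using ij by (auto intro!: sum.cong simp: a poly_entry_symmetric[OF X, of j] poly_entry_symmetric[OF X, of i])
    then show ?thesis
      using ij by (simp add: eval_pencil_entry[OF c] poly_entry_symmetric[OF X, of j])
  qed
  then have "transpose_mat ?P = ?P"
    using carrier_matD[OF eval_free_carrier[of n A X]] by (intro eq_matI) auto
  then show ?thesis
    using eval_free_carrier[of n A X] unfolding sym_mats_def by blast
qed

lemma quadratic_form_mat:
  assumes "M \<in> carrier_mat n n" "v \<in> carrier_vec n"
  shows "v \<bullet> (M *\<^sub>v v) = (\<Sum>i<n. \<Sum>j<n. M $$ (i, j) * v $ i * (v $ j :: real))"
proof -
  have "v \<bullet> (M *\<^sub>v v) = (\<Sum>i<n. v $ i * (\<Sum>j<n. M $$ (i, j) * v $ j))"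
    using assms by (simp add: scalar_prod_def atLeast0LessThan)
  also have "\<dots> = (\<Sum>i<n. \<Sum>j<n. M $$ (i, j) * v $ i * v $ j)"
    by (simp add: sum_distrib_left mult_ac)
  finally show ?thesis .
qed

lemma pos_def_iff:
  assumes M: "M \<in> sym_mats n"
  shows "pos_def M \<longleftrightarrow> (\<forall>x. (\<exists>i<n. x i \<noteq> 0) \<longrightarrow> (\<Sum>i<n. \<Sum>j<n. M $$ (i, j) * x i * x j) > 0)"
proof -
  have c: "M \<in> carrier_mat n n" "dim_row M = n"
    using M by (auto simp: sym_mats_def)
  have "(\<Sum>i<n. \<Sum>j<n. M $$ (i, j) * x i * x j) > 0"
    if pd: "pos_def M" and x: "\<exists>i<n. x i \<noteq> 0" for x
  proof -
    have "vec n x \<noteq> 0\<^sub>v n"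
      using x by (auto simp: vec_eq_iff)
    then have "vec n x \<bullet> (M *\<^sub>v vec n x) > 0"
      using pd c by (auto simp: pos_def_def)
    then show ?thesis
      by (simp add: quadratic_form_mat[OF c(1)])
  qed
  moreover have "pos_def M"
    if h: "\<forall>x. (\<exists>i<n. x i \<noteq> 0) \<longrightarrow> (\<Sum>i<n. \<Sum>j<n. M $$ (i, j) * x i * x j) > 0"
  proof -
    have "v \<bullet> (M *\<^sub>v v) > 0" if v: "v \<in> carrier_vec n" "v \<noteq> 0\<^sub>v n" for v
    proof -
      have "\<exists>i<n. v $ i \<noteq> 0"
        using v by (auto simp: vec_eq_iff)
      then show ?thesis
        using h[rule_format, of "($) v"] by (simp add: quadratic_form_mat[OF c(1) v(1)])
    qed
    then show ?thesis
      using M c by (auto simp: pos_def_def)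
  qed
  ultimately show ?thesis by blast
qed

text \<open>The Frobenius norm is polynomial in the entries, so it is the convenient bound for the norm constraint.\<close>

lemma op_norm_le_frobenius:
  assumes M: "M \<in> carrier_mat n n"
  shows "op_norm M \<le> sqrt (\<Sum>i<n. \<Sum>j<n. (M $$ (i, j))\<^sup>2)"
  unfolding op_norm_def
proof (rule cSUP_least)
  show "{v \<in> carrier_vec (dim_col M). sqrt (v \<bullet> v) \<le> (1::real)} \<noteq> {}"
    by (auto intro!: exI[of _ "0\<^sub>v (dim_col M)"])
next
  fix v :: "real vec"
  assume "v \<in> {v \<in> carrier_vec (dim_col M). sqrt (v \<bullet> v) \<le> (1::real)}"
  then have v: "v \<in> carrier_vec n" "v \<bullet> v \<le> 1"
    using M by (auto simp: real_sqrt_le_1_iff)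
  have vv: "v \<bullet> v = (\<Sum>j<n. (v $ j)\<^sup>2)"
    using v by (simp add: scalar_prod_def atLeast0LessThan power2_eq_square)
  have "(M *\<^sub>v v) \<bullet> (M *\<^sub>v v) = (\<Sum>i<n. (\<Sum>j<n. M $$ (i, j) * v $ j)\<^sup>2)"
    using M v by (simp add: scalar_prod_def atLeast0LessThan power2_eq_square)
  also have "\<dots> \<le> (\<Sum>i<n. (\<Sum>j<n. (M $$ (i, j))\<^sup>2) * (\<Sum>j<n. (v $ j)\<^sup>2))"
    by (intro sum_mono Cauchy_Schwarz_ineq_sum)
  also have "\<dots> \<le> (\<Sum>i<n. (\<Sum>j<n. (M $$ (i, j))\<^sup>2) * 1)"
    using v unfolding vv by (intro sum_mono mult_left_mono sum_nonneg) auto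
  finally show "sqrt ((M *\<^sub>v v) \<bullet> (M *\<^sub>v v)) \<le> sqrt (\<Sum>i<n. \<Sum>j<n. (M $$ (i, j))\<^sup>2)"
    by simp
qed

section \<open>Bordered diagonal matrices\<close>

text \<open>The test points: the diagonal matrix of the \<open>x i\<close>, extended by one coordinate with eigenvalue 0
and coupled to it by \<open>t * h\<close>. Flipping the sign of the new coordinate conjugates the matrix at \<open>t\<close> to the one
at \<open>-t\<close>, so the segment between the two has its midpoint at the uncoupled matrix.\<close>

definition bordered :: "nat \<Rightarrow> (nat \<Rightarrow> real) \<Rightarrow> (nat \<Rightarrow> real) \<Rightarrow> real \<Rightarrow> real mat" where
  "bordered N x h t = mat (Suc N) (Suc N) (\<lambda>(i, j).
     if i < N then (if j < N then (if i = j then x i else 0) else t * h i)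
     else (if j < N then t * h j else 0))"

definition weight :: "nat \<Rightarrow> (nat \<Rightarrow> nat \<Rightarrow> real) \<Rightarrow> real \<Rightarrow> real mat" where
  "weight N B b = mat (Suc N) (Suc N) (\<lambda>(i, j).
     if i < N \<and> j < N then B i j else if i = j then b else 0)"

text \<open>The deviation of the \<open>m\<close>-th power of a bordered matrix from the power of its diagonal part: with \<open>\<tau> = t\<^sup>2\<close>,
the diagonal block changes by \<open>t\<^sup>2 * bulk\<close>, the last column is \<open>t * edge\<close>, and the last diagonal entry is \<open>corner\<close>.
Dividing out the powers of \<open>t\<close> at this stage leaves functions that have limits at \<open>t = 0\<close>.\<close>

fun bulk :: "nat \<Rightarrow> (nat \<Rightarrow> real) \<Rightarrow> (nat \<Rightarrow> real) \<Rightarrow> real \<Rightarrow> nat \<Rightarrow> nat \<Rightarrow> nat \<Rightarrow> real"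
  and edge :: "nat \<Rightarrow> (nat \<Rightarrow> real) \<Rightarrow> (nat \<Rightarrow> real) \<Rightarrow> real \<Rightarrow> nat \<Rightarrow> nat \<Rightarrow> real" where
  "bulk N x h \<tau> 0 i j = 0"
| "bulk N x h \<tau> (Suc m) i j = bulk N x h \<tau> m i j * x j + edge N x h \<tau> m i * h j"
| "edge N x h \<tau> 0 i = 0"
| "edge N x h \<tau> (Suc m) i = x i ^ m * h i + \<tau> * (\<Sum>l<N. bulk N x h \<tau> m i l * h l)"

fun corner :: "nat \<Rightarrow> (nat \<Rightarrow> real) \<Rightarrow> (nat \<Rightarrow> real) \<Rightarrow> real \<Rightarrow> nat \<Rightarrow> real" where
  "corner N x h \<tau> 0 = 1"
| "corner N x h \<tau> (Suc m) = \<tau> * (\<Sum>l<N. edge N x h \<tau> m l * h l)"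

lemma bordered_sym: "bordered N x h t \<in> sym_mats (Suc N)"
  by (auto simp: sym_mats_def bordered_def intro!: eq_matI)

lemma weight_sym:
  assumes "\<And>i j. i < N \<Longrightarrow> j < N \<Longrightarrow> B i j = B j i"
  shows "weight N B b \<in> sym_mats (Suc N)"
  using assms by (auto simp: sym_mats_def weight_def intro!: eq_matI)

lemma bordered_carrier: "bordered N x h t \<in> carrier_mat (Suc N) (Suc N)"
  by (simp add: bordered_def)

lemma weight_carrier: "weight N B b \<in> carrier_mat (Suc N) (Suc N)"
  by (simp add: weight_def)

lemma bordered_pow:
  shows "\<And>i j. i < N \<Longrightarrow> j < N \<Longrightarrow> (bordered N x h t ^\<^sub>m m) $$ (i, j) =
      (if i = j then x i ^ m else 0) + t\<^sup>2 * bulk N x h (t\<^sup>2) m i j"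
    and "\<And>i. i < N \<Longrightarrow> (bordered N x h t ^\<^sub>m m) $$ (i, N) = t * edge N x h (t\<^sup>2) m i"
    and "(bordered N x h t ^\<^sub>m m) $$ (N, N) = corner N x h (t\<^sup>2) m"
proof (induction m)
  case 0
  {
    case 1
    then show ?case by (simp add: bordered_def)
  next
    case 2
    then show ?case by (simp add: bordered_def)
  next
    case 3
    then show ?case by (simp add: bordered_def)
  }
next
  case (Suc m)
  let ?Z = "bordered N x h t"
  have c: "?Z ^\<^sub>m m \<in> carrier_mat (Suc N) (Suc N)"
    by (simp add: bordered_carrier)
  have step: "(?Z ^\<^sub>m Suc m) $$ (i, j) =
      (\<Sum>l<N. (?Z ^\<^sub>m m) $$ (i, l) * ?Z $$ (l, j)) + (?Z ^\<^sub>m m) $$ (i, N) * ?Z $$ (N, j)"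
    if "i < Suc N" "j < Suc N" for i j
    using mat_mult_entry[OF c bordered_carrier that] by (simp del: index_mult_mat)
  have last_row: "(?Z ^\<^sub>m m) $$ (N, l) = t * edge N x h (t\<^sup>2) m l" if "l < N" for l
    using symmetric_entry[OF pow_mat_symmetric[OF bordered_sym] c, of N l] that Suc(2)[of l] by simp
  have Z: "?Z $$ (l, j) = (if l = j then x j else 0)" "?Z $$ (l, N) = t * h l"
    "?Z $$ (N, j) = t * h j" if "l < N" "j < N" for l j
    using that by (auto simp: bordered_def)
  have Z': "?Z $$ (N, N) = 0"
    by (simp add: bordered_def)
  {
    case (1 i j)
    have "(\<Sum>l<N. (?Z ^\<^sub>m m) $$ (i, l) * ?Z $$ (l, j)) = (?Z ^\<^sub>m m) $$ (i, j) * x j"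
      using 1 by (simp add: Z if_distrib[of "\<lambda>u. _ * u"] cong: if_cong)
    then show ?case
      using 1 by (simp add: step Z Suc(1,2) algebra_simps power2_eq_square del: pow_mat.simps)
  next
    case (2 i)
    have "(\<Sum>l<N. (?Z ^\<^sub>m m) $$ (i, l) * ?Z $$ (l, N)) =
      (\<Sum>l<N. (if i = l then x i ^ m * (t * h l) else 0) + t\<^sup>2 * (t * (bulk N x h (t\<^sup>2) m i l * h l)))"
      by (rule sum.cong) (use 2 in \<open>auto simp: Z Suc(1) algebra_simps\<close>)
    also have "\<dots> = t * (x i ^ m * h i + t\<^sup>2 * (\<Sum>l<N. bulk N x h (t\<^sup>2) m i l * h l))"
      using 2 by (simp add: sum.distrib sum_distrib_left algebra_simps)
    finally show ?case
      using 2 by (simp add: step Z' del: pow_mat.simps)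
  next
    case 3
    have "(\<Sum>l<N. (?Z ^\<^sub>m m) $$ (N, l) * ?Z $$ (l, N)) = t\<^sup>2 * (\<Sum>l<N. edge N x h (t\<^sup>2) m l * h l)"
      by (simp add: last_row Z sum_distrib_left power2_eq_square algebra_simps)
    then show ?case
      by (simp add: step Z' del: pow_mat.simps)
  }
qed

text \<open>The divided differences of \<open>x ^ m\<close> at the nodes \<open>x, 0\<close> and \<open>x, 0, y\<close>. The node 0 is the eigenvalue of the
bordering coordinate. The recursion is the one of \<open>bulk\<close> and \<open>edge\<close> at \<open>\<tau> = 0\<close>; it avoids division and hence covers
coinciding nodes.\<close>

fun quot1 :: "nat \<Rightarrow> real \<Rightarrow> real" where
  "quot1 0 x = 0"
| "quot1 (Suc m) x = x ^ m"

fun quot2 :: "nat \<Rightarrow> real \<Rightarrow> real \<Rightarrow> real" where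
  "quot2 0 x y = 0"
| "quot2 (Suc m) x y = quot2 m x y * y + quot1 m x"

definition dd1 :: "real poly \<Rightarrow> real \<Rightarrow> real" where
  "dd1 q x = pair_coeffs q (\<lambda>m. quot1 m x)"

definition dd2 :: "real poly \<Rightarrow> real \<Rightarrow> real \<Rightarrow> real" where
  "dd2 q x y = pair_coeffs q (\<lambda>m. quot2 m x y)"

lemma bulk_edge_tendsto:
  assumes "(\<tau> \<longlongrightarrow> 0) F"
  shows "((\<lambda>t. bulk N x h (\<tau> t) m i j) \<longlongrightarrow> h i * h j * quot2 m (x i) (x j)) F \<and>
    ((\<lambda>t. edge N x h (\<tau> t) m i) \<longlongrightarrow> h i * quot1 m (x i)) F"
proof (induction m arbitrary: i j)
  case (Suc m)
  have b: "((\<lambda>t. bulk N x h (\<tau> t) m i j) \<longlongrightarrow> h i * h j * quot2 m (x i) (x j)) F" for i j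
    using Suc.IH by blast
  have e: "((\<lambda>t. edge N x h (\<tau> t) m i) \<longlongrightarrow> h i * quot1 m (x i)) F" for i
    using Suc.IH by blast
  have "((\<lambda>t. bulk N x h (\<tau> t) (Suc m) i j) \<longlongrightarrow>
      h i * h j * quot2 m (x i) (x j) * x j + h i * quot1 m (x i) * h j) F"
    by (simp, intro tendsto_intros b e)
  moreover have "((\<lambda>t. edge N x h (\<tau> t) (Suc m) i) \<longlongrightarrow>
      x i ^ m * h i + 0 * (\<Sum>l<N. h i * h l * quot2 m (x i) (x l) * h l)) F"
    by (simp only: edge.simps, intro tendsto_intros b assms)
  ultimately show ?case by (simp add: algebra_simps)
qed simp

lemma corner_tendsto:
  assumes "(\<tau> \<longlongrightarrow> 0) F"
  shows "((\<lambda>t. corner N x h (\<tau> t) m) \<longlongrightarrow> (if m = 0 then 1 else 0)) F"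
proof (cases m)
  case (Suc k)
  have "((\<lambda>t. \<tau> t * (\<Sum>l<N. edge N x h (\<tau> t) k l * h l)) \<longlongrightarrow>
      0 * (\<Sum>l<N. h l * quot1 k (x l) * h l)) F"
    by (intro tendsto_intros assms conjunct2[OF bulk_edge_tendsto])
  then show ?thesis using Suc by simp
qed simp

lemma pair_coeffs_tendsto:
  assumes "\<And>m. ((\<lambda>t. w t m) \<longlongrightarrow> w0 m) F"
  shows "((\<lambda>t. pair_coeffs q (w t)) \<longlongrightarrow> pair_coeffs q w0) F"
  unfolding pair_coeffs_def by (intro tendsto_intros assms)

lemma pair_coeffs_add: "pair_coeffs q (\<lambda>m. u m + w m) = pair_coeffs q u + pair_coeffs q w"
  by (simp add: pair_coeffs_def distrib_left sum.distrib)

lemma pair_coeffs_scale: "pair_coeffs q (\<lambda>m. c * w m) = c * pair_coeffs q w"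
  by (simp add: pair_coeffs_def sum_distrib_left mult.left_commute)

lemma pair_coeffs_power: "pair_coeffs q (\<lambda>m. y ^ m) = poly q y"
  by (simp add: pair_coeffs_def poly_altdef)

lemma pair_coeffs_zero [simp]: "pair_coeffs q (\<lambda>m. 0) = 0"
  by (simp add: pair_coeffs_def)

lemma poly_entry_bordered:
  shows "i < N \<Longrightarrow> j < N \<Longrightarrow> poly_entry q (bordered N x h t) i j =
      (if i = j then poly q (x i) else 0) + t\<^sup>2 * pair_coeffs q (\<lambda>m. bulk N x h (t\<^sup>2) m i j)"
    and "i < N \<Longrightarrow> poly_entry q (bordered N x h t) i N = t * pair_coeffs q (\<lambda>m. edge N x h (t\<^sup>2) m i)"
    and "poly_entry q (bordered N x h t) N N = pair_coeffs q (corner N x h (t\<^sup>2))"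
  by (auto simp: poly_entry_def bordered_pow pair_coeffs_add pair_coeffs_scale pair_coeffs_power)

text \<open>The diagonal block of the evaluated pencil at \<open>t = 0\<close>. Up to the contribution of \<open>f\<close> its entries are those of \<open>B\<close>
multiplied by \<open>poly r (x i) + poly r (x j)\<close>, so where \<open>r\<close> is positive every symmetric
block can be prescribed by solving for \<open>B\<close>.\<close>

definition base_form :: "real poly \<Rightarrow> real poly \<Rightarrow> (nat \<Rightarrow> real) \<Rightarrow> (nat \<Rightarrow> nat \<Rightarrow> real) \<Rightarrow> nat \<Rightarrow> nat \<Rightarrow> real" where
  "base_form r f x B i j =
     (poly r (x i) + poly r (x j)) * B i j - (if i = j then 2 * poly f (x i) else 0)"

text \<open>The weight has no entries that couple the bordering coordinate to the rest, so the powers of \<open>t\<close> in the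
evaluated pencil are distributed as in the powers of the bordered matrix: second order inside the diagonal block, first
order in the border.\<close>

lemma pencil_bordered_expansion:
  fixes N :: nat and x h :: "nat \<Rightarrow> real" and B :: "nat \<Rightarrow> nat \<Rightarrow> real" and b :: real
    and r f :: "real poly"
  obtains T E c where
    "\<And>t i j. i < N \<Longrightarrow> j < N \<Longrightarrow>
       eval_free (Suc N) (weight N B b) (bordered N x h t) (pencil r f) $$ (i, j) =
       base_form r f x B i j + t\<^sup>2 * T t i j"
    "\<And>t i. i < N \<Longrightarrow>
       eval_free (Suc N) (weight N B b) (bordered N x h t) (pencil r f) $$ (i, N) = t * E t i"
    "\<And>t. eval_free (Suc N) (weight N B b) (bordered N x h t) (pencil r f) $$ (N, N) = c t"
    "\<And>i j. i < N \<Longrightarrow> j < N \<Longrightarrow> ((\<lambda>t. T t i j) \<longlongrightarrow>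
       (\<Sum>l<N. h i * h l * dd2 r (x i) (x l) * B l j) + (\<Sum>l<N. B i l * (h l * h j * dd2 r (x l) (x j)))
       - 2 * (h i * h j * dd2 f (x i) (x j))) (at 0)"
    "\<And>i. i < N \<Longrightarrow> ((\<lambda>t. E t i) \<longlongrightarrow>
       b * (h i * dd1 r (x i)) + (\<Sum>l<N. B i l * (h l * dd1 r (x l))) - 2 * (h i * dd1 f (x i))) (at 0)"
    "(c \<longlongrightarrow> 2 * b * poly r 0 - 2 * poly f 0) (at 0)"
proof -
  define P where "P t i j = eval_free (Suc N) (weight N B b) (bordered N x h t) (pencil r f) $$ (i, j)" for t i j
  define Q where "Q q i j = h i * h j * dd2 q (x i) (x j)" for q i j
  define R where "R q i = h i * dd1 q (x i)" for q i
  define T where "T t i j = (\<Sum>l<N. pair_coeffs r (\<lambda>m. bulk N x h (t\<^sup>2) m i l) * B l j) +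
    (\<Sum>l<N. B i l * pair_coeffs r (\<lambda>m. bulk N x h (t\<^sup>2) m l j)) - 2 * pair_coeffs f (\<lambda>m. bulk N x h (t\<^sup>2) m i j)"
    for t i j
  define E where "E t i = b * pair_coeffs r (\<lambda>m. edge N x h (t\<^sup>2) m i) +
    (\<Sum>l<N. B i l * pair_coeffs r (\<lambda>m. edge N x h (t\<^sup>2) m l)) - 2 * pair_coeffs f (\<lambda>m. edge N x h (t\<^sup>2) m i)"
    for t i
  define c where "c t = 2 * b * pair_coeffs r (corner N x h (t\<^sup>2)) - 2 * pair_coeffs f (corner N x h (t\<^sup>2))"
    for t
  have W: "weight N B b $$ (i, j) = B i j" "weight N B b $$ (i, N) = 0" "weight N B b $$ (N, j) = 0"
    "weight N B b $$ (N, N) = b" if "i < N" "j < N" for i j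
    using that by (auto simp: weight_def)
  have W': "weight N B b $$ (N, N) = b"
    by (auto simp: weight_def)
  note entry = eval_pencil_entry[OF weight_carrier bordered_carrier, of _ N _ B b x h]
  have P1: "P t i j = base_form r f x B i j + t\<^sup>2 * T t i j" if ij: "i < N" "j < N" for t i j
  proof -
    have "(\<Sum>l<N. poly_entry r (bordered N x h t) i l * B l j) =
      (\<Sum>l<N. (if i = l then poly r (x i) * B i j else 0) + t\<^sup>2 * (pair_coeffs r (\<lambda>m. bulk N x h (t\<^sup>2) m i l) * B l j))"
      by (rule sum.cong) (use ij in \<open>auto simp: poly_entry_bordered algebra_simps\<close>)
    then have 1: "(\<Sum>l<N. poly_entry r (bordered N x h t) i l * B l j) =
      poly r (x i) * B i j + t\<^sup>2 * (\<Sum>l<N. pair_coeffs r (\<lambda>m. bulk N x h (t\<^sup>2) m i l) * B l j)"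
      using ij by (simp add: sum.distrib sum_distrib_left)
    have "(\<Sum>l<N. B i l * poly_entry r (bordered N x h t) l j) =
      (\<Sum>l<N. (if l = j then poly r (x j) * B i j else 0) + t\<^sup>2 * (B i l * pair_coeffs r (\<lambda>m. bulk N x h (t\<^sup>2) m l j)))"
      by (rule sum.cong) (use ij in \<open>auto simp: poly_entry_bordered algebra_simps\<close>)
    then have 2: "(\<Sum>l<N. B i l * poly_entry r (bordered N x h t) l j) =
      poly r (x j) * B i j + t\<^sup>2 * (\<Sum>l<N. B i l * pair_coeffs r (\<lambda>m. bulk N x h (t\<^sup>2) m l j))"
      using ij by (simp add: sum.distrib sum_distrib_left)
    have "P t i j = (\<Sum>l<N. poly_entry r (bordered N x h t) i l * B l j) +
        (\<Sum>l<N. B i l * poly_entry r (bordered N x h t) l j) - 2 * poly_entry f (bordered N x h t) i j"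
      unfolding P_def using ij by (simp add: entry W)
    then show ?thesis
      unfolding 1 2 T_def base_form_def poly_entry_bordered(1)[OF ij]
      by (cases "i = j") (simp_all add: algebra_simps)
  qed
  moreover have P2: "P t i N = t * E t i" if i: "i < N" for t i
  proof -
    have "(\<Sum>l<N. B i l * poly_entry r (bordered N x h t) l N) =
      t * (\<Sum>l<N. B i l * pair_coeffs r (\<lambda>m. edge N x h (t\<^sup>2) m l))"
      by (simp add: poly_entry_bordered sum_distrib_left algebra_simps)
    then show ?thesis
      unfolding P_def
      using i by (simp add: entry W W' E_def poly_entry_bordered algebra_simps)
  qed
  moreover have P3: "P t N N = c t" for t
    unfolding P_def by (simp add: entry W W' c_def poly_entry_bordered algebra_simps)
  moreover
  have sq: "((\<lambda>t::real. t\<^sup>2) \<longlongrightarrow> 0) (at 0)"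
    by (rule tendsto_eq_intros refl | simp)+
  have bulk: "((\<lambda>t. pair_coeffs q (\<lambda>m. bulk N x h (t\<^sup>2) m i j)) \<longlongrightarrow> Q q i j) (at 0)" for q i j
    unfolding Q_def dd2_def pair_coeffs_scale[symmetric]
    by (intro pair_coeffs_tendsto conjunct1[OF bulk_edge_tendsto] sq)
  have edge: "((\<lambda>t. pair_coeffs q (\<lambda>m. edge N x h (t\<^sup>2) m i)) \<longlongrightarrow> R q i) (at 0)" for q i
    unfolding R_def dd1_def pair_coeffs_scale[symmetric]
    by (intro pair_coeffs_tendsto conjunct2[OF bulk_edge_tendsto] sq)
  have corner: "((\<lambda>t. pair_coeffs q (corner N x h (t\<^sup>2))) \<longlongrightarrow> poly q 0) (at 0)" for q
  proof -
    have "((\<lambda>t. pair_coeffs q (corner N x h (t\<^sup>2))) \<longlongrightarrow> pair_coeffs q (\<lambda>m. if m = 0 then 1 else 0)) (at 0)"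
      by (intro pair_coeffs_tendsto corner_tendsto sq)
    then show ?thesis
      by (simp add: pair_coeffs_def poly_0_coeff_0 if_distrib[of "\<lambda>u. _ * u"] cong: if_cong)
  qed
  have "((\<lambda>t. T t i j) \<longlongrightarrow>
       (\<Sum>l<N. Q r i l * B l j) + (\<Sum>l<N. B i l * Q r l j) - 2 * Q f i j) (at 0)" for i j
    unfolding T_def by (intro tendsto_intros bulk)
  moreover have "((\<lambda>t. E t i) \<longlongrightarrow> b * R r i + (\<Sum>l<N. B i l * R r l) - 2 * R f i) (at 0)" for i
    unfolding E_def by (intro tendsto_intros edge)
  moreover have "(c \<longlongrightarrow> 2 * b * poly r 0 - 2 * poly f 0) (at 0)"
    unfolding c_def by (intro tendsto_intros corner)
  ultimately show thesis
    using that[of T E c] unfolding P_def Q_def R_def by blast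
qed

section \<open>Positive definiteness under perturbation\<close>

text \<open>Entrywise convergence suffices because the size is fixed: entrywise errors below \<open>\<delta>\<close> change the form by at
most \<open>n * \<delta>\<close> times the squared length. The predicate \<open>S\<close> allows the limit to be coercive on a subspace only.\<close>

lemma eventually_positive_form:
  fixes M :: "'a \<Rightarrow> nat \<Rightarrow> nat \<Rightarrow> real"
  assumes lim: "\<And>i j. i < n \<Longrightarrow> j < n \<Longrightarrow> ((\<lambda>t. M t i j) \<longlongrightarrow> L i j) F"
    and "\<kappa> > 0"
    and coercive: "\<And>y. S y \<Longrightarrow> (\<Sum>i<n. \<Sum>j<n. L i j * y i * y j) \<ge> \<kappa> * (\<Sum>i<n. (y i)\<^sup>2)"
  shows "\<forall>\<^sub>F t in F. \<forall>y. S y \<longrightarrow> (\<exists>i<n. y i \<noteq> 0) \<longrightarrow> 0 < (\<Sum>i<n. \<Sum>j<n. M t i j * y i * y j)"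
proof -
  \<comment> \<open>The error is at most \<open>n * \<delta>\<close>, which leaves \<open>\<kappa> - n * \<delta> = \<delta>\<close>.\<close>
  define \<delta> where "\<delta> = \<kappa> / (real n + 1)"
  have \<delta>: "\<delta> > 0"
    using \<open>\<kappa> > 0\<close> by (simp add: \<delta>_def)
  have "\<forall>\<^sub>F t in F. \<forall>i\<in>{..<n}. \<forall>j\<in>{..<n}. \<bar>M t i j - L i j\<bar> < \<delta>"
    by (intro eventually_ball_finite finite_lessThan ballI)
      (use lim \<delta> in \<open>auto simp: tendsto_iff dist_real_def\<close>)
  then show ?thesis
  proof eventually_elim
    case (elim t)
    show ?case
    proof (intro allI impI)
      fix y assume S: "S y" and nz: "\<exists>i<n. y i \<noteq> (0::real)"
      define s where "s = (\<Sum>i<n. (y i)\<^sup>2)"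
      have s: "s > 0"
        using nz unfolding s_def by (auto intro!: sum_pos2)
      have "L i j * y i * y j - M t i j * y i * y j \<le> \<delta> * ((y i)\<^sup>2 / 2 + (y j)\<^sup>2 / 2)"
        if "i < n" "j < n" for i j
      proof -
        have "L i j * y i * y j - M t i j * y i * y j = (L i j - M t i j) * (y i * y j)"
          by (simp add: algebra_simps)
        also have "\<dots> \<le> \<bar>M t i j - L i j\<bar> * \<bar>y i * y j\<bar>"
          by (simp flip: abs_mult add: abs_minus_commute)
        also have "\<dots> \<le> \<delta> * \<bar>y i * y j\<bar>"
          by (rule mult_right_mono) (use elim that in \<open>auto intro: less_imp_le\<close>)
        also have "\<bar>y i * y j\<bar> \<le> (y i)\<^sup>2 / 2 + (y j)\<^sup>2 / 2"
          using sum_squares_bound[of "\<bar>y i\<bar>" "\<bar>y j\<bar>"] by (simp add: abs_mult field_simps)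
        finally show ?thesis
          using \<delta> by simp
      qed
      then have "(\<Sum>i<n. \<Sum>j<n. L i j * y i * y j - M t i j * y i * y j)
          \<le> (\<Sum>i<n. \<Sum>j<n. \<delta> * ((y i)\<^sup>2 / 2 + (y j)\<^sup>2 / 2))"
        by (intro sum_mono) auto
      also have "\<dots> = \<delta> * real n * s"
        by (simp add: s_def sum_distrib_left[symmetric] sum.distrib sum_divide_distrib[symmetric] field_simps)
      finally have "\<kappa> * s - \<delta> * real n * s \<le> (\<Sum>i<n. \<Sum>j<n. M t i j * y i * y j)"
        using coercive[OF S] by (simp add: sum_subtractf s_def)
      moreover have "\<kappa> * s - \<delta> * real n * s = \<delta> * s"
        by (simp add: \<delta>_def field_simps)
      ultimately show "0 < (\<Sum>i<n. \<Sum>j<n. M t i j * y i * y j)"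
        using s \<delta> mult_pos_pos[of \<delta> s] by linarith
    qed
  qed
qed

lemma two_by_two_coercive:
  fixes a b c :: real
  assumes "c > 0" "b\<^sup>2 < a * c"
  obtains \<kappa> where "\<kappa> > 0" "\<And>x y. \<kappa> * (x\<^sup>2 + y\<^sup>2) \<le> a * x\<^sup>2 + 2 * b * x * y + c * y\<^sup>2"
proof -
  have "a * c > 0"
    using assms(2) by (smt (verit) zero_le_power2)
  then have a: "a > 0"
    using assms(1) zero_less_mult_pos2 by blast
  define D where "D = a * c - b\<^sup>2"
  \<comment> \<open>Determinant over trace is a lower bound for the smaller eigenvalue.\<close>
  define \<kappa> where "\<kappa> = D / (a + c)"
  have D: "D > 0" using assms by (simp add: D_def)
  have \<kappa>: "\<kappa> > 0" "\<kappa> * (a + c) = D" using D a assms by (auto simp: \<kappa>_def)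
  have "\<kappa> < c"
  proof -
    have "D < c * (a + c)"
      using assms(1) by (simp add: D_def algebra_simps) (smt (verit) zero_le_power2 zero_less_mult_iff)
    then show ?thesis using \<kappa> a assms(1) by (metis add_pos_pos mult_less_cancel_right_pos)
  qed
  have "\<kappa> * (x\<^sup>2 + y\<^sup>2) \<le> a * x\<^sup>2 + 2 * b * x * y + c * y\<^sup>2" for x y
  proof -
    have "(c - \<kappa>) * ((a - \<kappa>) * x\<^sup>2 + 2 * b * x * y + (c - \<kappa>) * y\<^sup>2) =
      ((c - \<kappa>) * y + b * x)\<^sup>2 + (a * c - b\<^sup>2 - \<kappa> * (a + c) + \<kappa>\<^sup>2) * x\<^sup>2"
      by (simp add: power2_eq_square algebra_simps)
    also have "\<dots> = ((c - \<kappa>) * y + b * x)\<^sup>2 + \<kappa>\<^sup>2 * x\<^sup>2"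
      using \<kappa>(2) by (simp add: D_def)
    also have "\<dots> \<ge> 0" by simp
    finally have "(a - \<kappa>) * x\<^sup>2 + 2 * b * x * y + (c - \<kappa>) * y\<^sup>2 \<ge> 0"
      using \<open>\<kappa> < c\<close> by (simp add: zero_le_mult_iff)
    then show ?thesis by (simp add: algebra_simps)
  qed
  then show thesis using that \<kappa>(1) by blast
qed

text \<open>A degenerate form \<open>C\<close> with kernel \<open>v\<close> becomes definite under a perturbation of second order in its own
block and first order in an added coordinate, provided that the second-order gain along \<open>v\<close> exceeds the Schur complement
loss \<open>(\<Sum>i<N. v i * E0 i)\<^sup>2 / c0\<close>. The reason is a change of scale: in the coordinates \<open>x = \<alpha> v + t y\<close>, with \<open>y 0 = 0\<close>, and with the
added coordinate also divided by \<open>t\<close>, the form is \<open>t\<^sup>2\<close> times one that converges as \<open>t\<close> tends to 0. The limit is the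
direct sum of \<open>C\<close> on the vectors with \<open>y 0 = 0\<close>, where it is coercive, and of a definite form in two variables.\<close>

lemma degenerate_form_perturbation:
  fixes P T :: "real \<Rightarrow> nat \<Rightarrow> nat \<Rightarrow> real" and C T0 :: "nat \<Rightarrow> nat \<Rightarrow> real"
    and E :: "real \<Rightarrow> nat \<Rightarrow> real" and c :: "real \<Rightarrow> real" and E0 v :: "nat \<Rightarrow> real" and c0 \<kappa> :: real
  assumes "0 < N" and v0: "v 0 \<noteq> 0"
    and C_sym: "\<And>i j. i < N \<Longrightarrow> j < N \<Longrightarrow> C i j = C j i"
    and C_ker: "\<And>i. i < N \<Longrightarrow> (\<Sum>j<N. C i j * v j) = 0"
    and "\<kappa> > 0"
    and C_coercive: "\<And>u. u 0 = 0 \<Longrightarrow> \<kappa> * (\<Sum>i<N. (u i)\<^sup>2) \<le> (\<Sum>i<N. \<Sum>j<N. C i j * u i * u j)"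
    and P_bulk: "\<And>t i j. i < N \<Longrightarrow> j < N \<Longrightarrow> P t i j = C i j + t\<^sup>2 * T t i j"
    and P_edge: "\<And>t i. i < N \<Longrightarrow> P t i N = t * E t i" "\<And>t i. i < N \<Longrightarrow> P t N i = t * E t i"
    and P_corner: "\<And>t. P t N N = c t"
    and T_lim: "\<And>i j. i < N \<Longrightarrow> j < N \<Longrightarrow> ((\<lambda>t. T t i j) \<longlongrightarrow> T0 i j) (at 0)"
    and E_lim: "\<And>i. i < N \<Longrightarrow> ((\<lambda>t. E t i) \<longlongrightarrow> E0 i) (at 0)"
    and c_lim: "(c \<longlongrightarrow> c0) (at 0)"
    and "c0 > 0"
    and schur: "(\<Sum>i<N. v i * E0 i)\<^sup>2 < (\<Sum>i<N. \<Sum>j<N. T0 i j * v i * v j) * c0"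
  shows "\<forall>\<^sub>F t in at 0. \<forall>x. (\<exists>i<Suc N. x i \<noteq> 0) \<longrightarrow> 0 < (\<Sum>i<Suc N. \<Sum>j<Suc N. P t i j * x i * x j)"
proof -
  \<comment> \<open>The rescaled form, with index \<open>N\<close> for the added coordinate and \<open>Suc N\<close> for \<open>\<alpha>\<close>, and its limit.\<close>
  define M where "M t i j =
    (if i < N then (if j < N then C i j + t\<^sup>2 * T t i j else if j = N then t * E t i
                    else t * (\<Sum>l<N. T t i l * v l))
     else if i = N then (if j < N then t * E t j else if j = N then c t else (\<Sum>l<N. v l * E t l))
     else (if j < N then t * (\<Sum>l<N. T t l j * v l) else if j = N then (\<Sum>l<N. v l * E t l)
           else (\<Sum>k<N. \<Sum>l<N. T t k l * v k * v l)))" for t i j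
  define L where "L i j =
    (if i < N then (if j < N then C i j else 0)
     else if i = N then (if j < N then 0 else if j = N then c0 else (\<Sum>l<N. v l * E0 l))
     else (if j < N then 0 else if j = N then (\<Sum>l<N. v l * E0 l)
           else (\<Sum>k<N. \<Sum>l<N. T0 k l * v k * v l)))" for i j
  have t0: "((\<lambda>t::real. t) \<longlongrightarrow> 0) (at 0)"
    by (rule tendsto_ident_at)
  have M_lim: "((\<lambda>t. M t i j) \<longlongrightarrow> L i j) (at 0)" for i j
  proof -
    have 1: "((\<lambda>t. C i j + t\<^sup>2 * T t i j) \<longlongrightarrow> C i j + 0\<^sup>2 * T0 i j) (at 0)" if "i < N" "j < N"
      by (intro tendsto_intros t0 T_lim that)
    have 2: "((\<lambda>t. t * E t l) \<longlongrightarrow> 0 * E0 l) (at 0)" if "l < N" for l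
      by (intro tendsto_intros t0 E_lim that)
    have 3: "((\<lambda>t. t * (\<Sum>l<N. T t i l * v l)) \<longlongrightarrow> 0 * (\<Sum>l<N. T0 i l * v l)) (at 0)" if "i < N"
      by (intro tendsto_intros t0 T_lim that) auto
    have 4: "((\<lambda>t. t * (\<Sum>l<N. T t l j * v l)) \<longlongrightarrow> 0 * (\<Sum>l<N. T0 l j * v l)) (at 0)" if "j < N"
      by (intro tendsto_intros t0 T_lim that) auto
    have 5: "((\<lambda>t. \<Sum>l<N. v l * E t l) \<longlongrightarrow> (\<Sum>l<N. v l * E0 l)) (at 0)"
      by (intro tendsto_intros E_lim) auto
    have 6: "((\<lambda>t. \<Sum>k<N. \<Sum>l<N. T t k l * v k * v l) \<longlongrightarrow> (\<Sum>k<N. \<Sum>l<N. T0 k l * v k * v l)) (at 0)"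
      by (intro tendsto_intros T_lim) auto
    show ?thesis
      unfolding M_def L_def using 1 2 3 4 5 6 c_lim by simp
  qed
  obtain \<kappa>' where "\<kappa>' > 0" and \<kappa>': "\<And>x y. \<kappa>' * (x\<^sup>2 + y\<^sup>2) \<le>
      (\<Sum>i<N. \<Sum>j<N. T0 i j * v i * v j) * x\<^sup>2 + 2 * (\<Sum>i<N. v i * E0 i) * x * y + c0 * y\<^sup>2"
    using two_by_two_coercive[OF \<open>c0 > 0\<close> schur] by blast
  define \<mu> where "\<mu> = min \<kappa> \<kappa>'"
  have \<mu>: "\<mu> > 0" "\<mu> \<le> \<kappa>" "\<mu> \<le> \<kappa>'"
    using \<open>\<kappa> > 0\<close> \<open>\<kappa>' > 0\<close> by (auto simp: \<mu>_def)
  have L_coercive: "\<mu> * (\<Sum>i<N+2. (y i)\<^sup>2) \<le> (\<Sum>i<N+2. \<Sum>j<N+2. L i j * y i * y j)" if "y 0 = 0" for y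
  proof -
    have "\<mu> * (\<Sum>i<N+2. (y i)\<^sup>2) = \<mu> * (\<Sum>i<N. (y i)\<^sup>2) + \<mu> * ((y (Suc N))\<^sup>2 + (y N)\<^sup>2)"
      by (simp add: algebra_simps)
    also have "\<dots> \<le> \<kappa> * (\<Sum>i<N. (y i)\<^sup>2) + \<kappa>' * ((y (Suc N))\<^sup>2 + (y N)\<^sup>2)"
      by (intro add_mono mult_right_mono \<mu>) (auto intro: sum_nonneg)
    also have "\<dots> \<le> (\<Sum>i<N. \<Sum>j<N. C i j * y i * y j) + ((\<Sum>i<N. \<Sum>j<N. T0 i j * v i * v j) * (y (Suc N))\<^sup>2 +
        2 * (\<Sum>i<N. v i * E0 i) * y (Suc N) * y N + c0 * (y N)\<^sup>2)"
      by (intro add_mono C_coercive \<kappa>' that)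
    also have "\<dots> = (\<Sum>i<N+2. \<Sum>j<N+2. L i j * y i * y j)"
      by (simp add: L_def power2_eq_square algebra_simps)
    finally show ?thesis .
  qed
  have "\<forall>\<^sub>F t in at 0. \<forall>y. y 0 = 0 \<longrightarrow> (\<exists>i<N+2. y i \<noteq> 0) \<longrightarrow>
      0 < (\<Sum>i<N+2. \<Sum>j<N+2. M t i j * y i * y j)"
    by (rule eventually_positive_form[of "N + 2" M L "at 0" \<mu> "\<lambda>y. y 0 = 0"])
      (use M_lim \<mu>(1) L_coercive in blast)+
  moreover have "\<forall>\<^sub>F t in at 0. t \<noteq> (0::real)"
    by (simp add: eventually_at_filter)
  ultimately show ?thesis
  proof eventually_elim
    case (elim t)
    show ?case
    proof (intro allI impI)
      fix x :: "nat \<Rightarrow> real"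
      assume nz: "\<exists>i<Suc N. x i \<noteq> 0"
      define \<alpha> where "\<alpha> = x 0 / v 0"
      define y where "y i = (if i < N then (x i - \<alpha> * v i) / t else if i = N then x N / t else \<alpha>)" for i
      have y0: "y 0 = 0"
        using \<open>0 < N\<close> v0 by (simp add: y_def \<alpha>_def)
      have xi: "x i = \<alpha> * v i + t * y i" if "i < N" for i
        using that elim(2) by (simp add: y_def)
      have xN: "x N = t * y N"
        using elim(2) by (simp add: y_def)
      have yN: "y (Suc N) = \<alpha>"
        by (simp add: y_def)
      have y_nz: "\<exists>i<N+2. y i \<noteq> 0"
      proof (rule ccontr)
        assume "\<not> ?thesis"
        then have "y i = 0" if "i < N + 2" for i
          using that by blast
        then have "\<forall>i<Suc N. x i = 0"
          using xi xN yN by (auto simp: less_Suc_eq)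
        then show False using nz by blast
      qed
      have C_ker': "(\<Sum>i<N. C i j * v i) = 0" if "j < N" for j
        using C_ker[OF that] C_sym[OF that] by simp
      have Cx: "(\<Sum>i<N. \<Sum>j<N. C i j * x i * x j) = t\<^sup>2 * (\<Sum>i<N. \<Sum>j<N. C i j * y i * y j)"
      proof -
        have "(\<Sum>i<N. \<Sum>j<N. C i j * x i * x j) =
          (\<Sum>i<N. x i * \<alpha> * (\<Sum>j<N. C i j * v j)) + (\<Sum>i<N. \<Sum>j<N. C i j * x i * (t * y j))"
          by (simp add: xi sum.distrib[symmetric] sum_distrib_left algebra_simps)
        also have "\<dots> = (\<Sum>i<N. \<Sum>j<N. C i j * x i * (t * y j))"
          by (simp add: C_ker)
        also have "\<dots> = (\<Sum>j<N. \<Sum>i<N. C i j * x i * (t * y j))"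
          by (rule sum.swap)
        also have "\<dots> = (\<Sum>j<N. t * y j * \<alpha> * (\<Sum>i<N. C i j * v i)) + (\<Sum>j<N. \<Sum>i<N. C i j * (t * y i) * (t * y j))"
          by (simp add: xi sum.distrib[symmetric] sum_distrib_left algebra_simps)
        also have "\<dots> = (\<Sum>j<N. \<Sum>i<N. C i j * (t * y i) * (t * y j))"
          by (simp add: C_ker')
        also have "\<dots> = (\<Sum>i<N. \<Sum>j<N. C i j * (t * y i) * (t * y j))"
          by (rule sum.swap)
        finally show ?thesis
          by (simp add: sum_distrib_left power2_eq_square algebra_simps)
      qed
      have Tx: "(\<Sum>i<N. \<Sum>j<N. T t i j * x i * x j) =
          t\<^sup>2 * (\<Sum>i<N. \<Sum>j<N. T t i j * y i * y j) + t * \<alpha> * (\<Sum>i<N. y i * (\<Sum>j<N. T t i j * v j))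
          + t * \<alpha> * (\<Sum>j<N. y j * (\<Sum>i<N. T t i j * v i)) + \<alpha>\<^sup>2 * (\<Sum>i<N. \<Sum>j<N. T t i j * v i * v j)"
      proof -
        have "(\<Sum>j<N. y j * (\<Sum>i<N. T t i j * v i)) = (\<Sum>i<N. \<Sum>j<N. T t i j * v i * y j)"
          by (subst sum.swap) (simp add: sum_distrib_left algebra_simps)
        then show ?thesis
          by (simp add: xi sum.distrib[symmetric] sum_distrib_left power2_eq_square algebra_simps)
      qed
      have Ex: "(\<Sum>i<N. E t i * x i) = t * (\<Sum>i<N. E t i * y i) + \<alpha> * (\<Sum>i<N. v i * E t i)"
        by (simp add: xi sum.distrib[symmetric] sum_distrib_left algebra_simps)
      have "(\<Sum>i<Suc N. \<Sum>j<Suc N. P t i j * x i * x j) =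
          (\<Sum>i<N. \<Sum>j<N. C i j * x i * x j) + t\<^sup>2 * (\<Sum>i<N. \<Sum>j<N. T t i j * x i * x j)
          + 2 * t * (\<Sum>i<N. E t i * x i) * x N + c t * (x N)\<^sup>2"
        by (simp add: P_bulk P_edge P_corner sum.distrib sum_distrib_left sum_distrib_right
            power2_eq_square algebra_simps)
      also have "\<dots> = t\<^sup>2 * ((\<Sum>i<N. \<Sum>j<N. C i j * y i * y j) + (\<Sum>i<N. \<Sum>j<N. T t i j * x i * x j)
          + 2 * (\<Sum>i<N. E t i * x i) * y N + c t * (y N)\<^sup>2)"
        unfolding Cx by (simp add: xN power2_eq_square algebra_simps)
      also have "(\<Sum>i<N. \<Sum>j<N. C i j * y i * y j) + (\<Sum>i<N. \<Sum>j<N. T t i j * x i * x j)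
          + 2 * (\<Sum>i<N. E t i * x i) * y N + c t * (y N)\<^sup>2 = (\<Sum>i<N+2. \<Sum>j<N+2. M t i j * y i * y j)"
        unfolding Tx Ex
        by (simp add: M_def yN sum.distrib sum_distrib_left sum_distrib_right power2_eq_square algebra_simps)
      finally show "0 < (\<Sum>i<Suc N. \<Sum>j<Suc N. P t i j * x i * x j)"
        using elim y0 y_nz by (simp add: zero_less_mult_iff)
    qed
  qed
qed

section \<open>Curvature at a degenerate point\<close>

lemma quot2_eq_sum: "quot2 (Suc (Suc m)) x y = (\<Sum>a\<le>m. x ^ a * y ^ (m - a))"
proof (induction m)
  case (Suc m)
  have "quot2 (Suc (Suc (Suc m))) x y = (\<Sum>a\<le>m. x ^ a * y ^ (m - a)) * y + x ^ Suc m"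
    using Suc by simp
  also have "(\<Sum>a\<le>m. x ^ a * y ^ (m - a)) * y = (\<Sum>a\<le>m. x ^ a * y ^ (Suc m - a))"
    by (simp add: sum_distrib_right sum_distrib_left Suc_diff_le mult_ac)
  finally show ?case by simp
qed simp

lemma quot2_commute: "quot2 m x y = quot2 m y x"
proof -
  consider "m = 0" | "m = Suc 0" | k where "m = Suc (Suc k)"
    by (metis not0_implies_Suc)
  then show ?thesis
  proof cases
    case 3
    have "(\<Sum>a\<le>k. x ^ a * y ^ (k - a)) = (\<Sum>a\<le>k. y ^ a * x ^ (k - a))"
      by (rule sum.reindex_bij_witness[of _ "\<lambda>a. k - a" "\<lambda>a. k - a"]) auto
    then show ?thesis
      unfolding 3 quot2_eq_sum .
  qed auto
qed

lemma dd2_commute: "dd2 q x y = dd2 q y x"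
  unfolding dd2_def by (subst quot2_commute) simp

definition matrix_convex :: "real poly \<Rightarrow> real poly \<Rightarrow> real \<Rightarrow> bool" where
  "matrix_convex r f \<epsilon> \<longleftrightarrow> (\<forall>n>0. \<forall>A \<in> sym_mats n.
      convex_mats {X \<in> sym_mats n. pos_def (eval_free n A X (pencil r f)) \<and> op_norm X < \<epsilon>})"

text \<open>The weight \<open>B\<close> is chosen so that the pencil at the uncoupled matrix is positive semidefinite with kernel \<open>v\<close>.
It is then not positive definite at the midpoint of the segment from \<open>-t\<close> to \<open>t\<close>, so by convexity the endpoints, which are
conjugate to each other, must fail as well for all small \<open>t\<close>. By \<open>degenerate_form_perturbation\<close> this forces the
second-order term along \<open>v\<close> to be no larger than the Schur complement of the border.\<close>

lemma curvature_test:
  fixes r f :: "real poly" and \<epsilon> b \<kappa> :: real and N :: nat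
    and x h v :: "nat \<Rightarrow> real" and B :: "nat \<Rightarrow> nat \<Rightarrow> real"
  defines "y \<equiv> \<lambda>i. \<Sum>j<N. B i j * v j"
  assumes conv: "matrix_convex r f \<epsilon>"
    and r_0: "poly r 0 = 1" and f_0: "poly f 0 = 0"
    and "0 < b" "0 < N" and v0: "v 0 \<noteq> 0"
    and B_sym: "\<And>i j. i < N \<Longrightarrow> j < N \<Longrightarrow> B i j = B j i"
    and ker: "\<And>i. i < N \<Longrightarrow> (\<Sum>j<N. base_form r f x B i j * v j) = 0"
    and "\<kappa> > 0"
    and coercive: "\<And>u. u 0 = 0 \<Longrightarrow>
      \<kappa> * (\<Sum>i<N. (u i)\<^sup>2) \<le> (\<Sum>i<N. \<Sum>j<N. base_form r f x B i j * u i * u j)"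
    and small: "(\<Sum>i<N. (x i)\<^sup>2) < \<epsilon>\<^sup>2" and "\<epsilon> > 0"
  shows "(2 * (\<Sum>i<N. \<Sum>j<N. v i * h i * dd2 r (x i) (x j) * h j * y j)
      - 2 * (\<Sum>i<N. \<Sum>j<N. v i * h i * dd2 f (x i) (x j) * h j * v j)) * (2 * b)
    \<le> (\<Sum>i<N. dd1 r (x i) * h i * (b * v i + y i) - 2 * dd1 f (x i) * h i * v i)\<^sup>2"
proof (rule ccontr)
  let ?A = "weight N B b"
  let ?Z = "bordered N x h"
  let ?S = "{X \<in> sym_mats (Suc N). pos_def (eval_free (Suc N) ?A X (pencil r f)) \<and> op_norm X < \<epsilon>}"
  let ?P = "\<lambda>t. eval_free (Suc N) ?A (?Z t) (pencil r f)"
  define T0 where "T0 i j = (\<Sum>l<N. h i * h l * dd2 r (x i) (x l) * B l j)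
    + (\<Sum>l<N. B i l * (h l * h j * dd2 r (x l) (x j))) - 2 * (h i * h j * dd2 f (x i) (x j))" for i j
  define E0 where "E0 i = b * (h i * dd1 r (x i)) + (\<Sum>l<N. B i l * (h l * dd1 r (x l)))
    - 2 * (h i * dd1 f (x i))" for i
  obtain T E c where
    bulk: "\<And>t i j. i < N \<Longrightarrow> j < N \<Longrightarrow> ?P t $$ (i, j) = base_form r f x B i j + t\<^sup>2 * T t i j"
    and edge: "\<And>t i. i < N \<Longrightarrow> ?P t $$ (i, N) = t * E t i"
    and corner: "\<And>t. ?P t $$ (N, N) = c t"
    and T_raw: "\<And>i j. i < N \<Longrightarrow> j < N \<Longrightarrow> ((\<lambda>t. T t i j) \<longlongrightarrow>
       (\<Sum>l<N. h i * h l * dd2 r (x i) (x l) * B l j) + (\<Sum>l<N. B i l * (h l * h j * dd2 r (x l) (x j)))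
       - 2 * (h i * h j * dd2 f (x i) (x j))) (at 0)"
    and E_raw: "\<And>i. i < N \<Longrightarrow> ((\<lambda>t. E t i) \<longlongrightarrow>
       b * (h i * dd1 r (x i)) + (\<Sum>l<N. B i l * (h l * dd1 r (x l))) - 2 * (h i * dd1 f (x i))) (at 0)"
    and c_raw: "(c \<longlongrightarrow> 2 * b * poly r 0 - 2 * poly f 0) (at 0)"
  proof (rule pencil_bordered_expansion[of N B b x h r f], goal_cases)
    case (1 T E c)
    show thesis by (rule that[of T E c]) (fact 1)+
  qed
  have T: "((\<lambda>t. T t i j) \<longlongrightarrow> T0 i j) (at 0)" if "i < N" "j < N" for i j
    unfolding T0_def by (rule T_raw[OF that])
  have E: "((\<lambda>t. E t i) \<longlongrightarrow> E0 i) (at 0)" if "i < N" for i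
    unfolding E0_def by (rule E_raw[OF that])
  have c: "(c \<longlongrightarrow> 2 * b) (at 0)"
    using c_raw by (simp add: r_0 f_0)
  have A: "?A \<in> sym_mats (Suc N)"
    by (rule weight_sym) (rule B_sym)
  have P_sym: "?P t \<in> sym_mats (Suc N)" for t
    by (rule eval_pencil_symmetric[OF A bordered_sym])
  have edge': "?P t $$ (N, i) = t * E t i" if "i < N" for t i
    using edge[OF that] symmetric_entry[of "?P t" "Suc N" N i] P_sym[of t] that
    by (auto simp: sym_mats_def)
  have By: "(\<Sum>l<N. B l j * v l) = y j" if "j < N" for j
    unfolding y_def by (rule sum.cong) (use B_sym that in auto)
  have T0v: "(\<Sum>i<N. \<Sum>j<N. T0 i j * v i * v j) =
      2 * (\<Sum>i<N. \<Sum>j<N. v i * h i * dd2 r (x i) (x j) * h j * y j)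
      - 2 * (\<Sum>i<N. \<Sum>j<N. v i * h i * dd2 f (x i) (x j) * h j * v j)"
  proof -
    have 1: "(\<Sum>i<N. \<Sum>j<N. (\<Sum>l<N. h i * h l * dd2 r (x i) (x l) * B l j) * v i * v j) =
      (\<Sum>i<N. \<Sum>l<N. v i * h i * dd2 r (x i) (x l) * h l * y l)"
    proof (rule sum.cong[OF refl])
      fix i
      show "(\<Sum>j<N. (\<Sum>l<N. h i * h l * dd2 r (x i) (x l) * B l j) * v i * v j) =
        (\<Sum>l<N. v i * h i * dd2 r (x i) (x l) * h l * y l)"
        unfolding y_def sum_distrib_right sum_distrib_left by (subst sum.swap) (simp add: algebra_simps)
    qed
    have 2: "(\<Sum>i<N. \<Sum>j<N. (\<Sum>l<N. B i l * (h l * h j * dd2 r (x l) (x j))) * v i * v j) =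
      (\<Sum>i<N. \<Sum>l<N. v i * h i * dd2 r (x i) (x l) * h l * y l)"
    proof -
      have summand: "(\<Sum>l<N. B i l * (h l * h j * dd2 r (x l) (x j))) * v i * v j =
          (\<Sum>l<N. v j * h j * dd2 r (x j) (x l) * h l * (B i l * v i))" for i j
        unfolding sum_distrib_right by (intro sum.cong refl, subst dd2_commute) (simp add: mult_ac)
      have "(\<Sum>i<N. \<Sum>j<N. \<Sum>l<N. v j * h j * dd2 r (x j) (x l) * h l * (B i l * v i)) =
          (\<Sum>j<N. \<Sum>i<N. \<Sum>l<N. v j * h j * dd2 r (x j) (x l) * h l * (B i l * v i))"
        by (rule sum.swap)
      also have "\<dots> = (\<Sum>j<N. \<Sum>l<N. \<Sum>i<N. v j * h j * dd2 r (x j) (x l) * h l * (B i l * v i))"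
        by (intro sum.cong refl sum.swap)
      also have "\<dots> = (\<Sum>j<N. \<Sum>l<N. v j * h j * dd2 r (x j) (x l) * h l * y l)"
        by (simp add: sum_distrib_left[symmetric] By)
      finally show ?thesis
        by (simp only: summand)
    qed
    have 3: "2 * (h i * h j * dd2 f (x i) (x j)) * v i * v j = 2 * (v i * h i * dd2 f (x i) (x j) * h j * v j)"
      for i j
      by (simp add: mult_ac)
    show ?thesis
      unfolding T0_def distrib_right left_diff_distrib sum.distrib sum_subtractf 1 2 3
      by (simp add: sum_distrib_left)
  qed
  have E0v: "(\<Sum>i<N. v i * E0 i) =
      (\<Sum>i<N. dd1 r (x i) * h i * (b * v i + y i) - 2 * dd1 f (x i) * h i * v i)"
  proof -
    have "(\<Sum>i<N. v i * (\<Sum>l<N. B i l * (h l * dd1 r (x l)))) =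
      (\<Sum>l<N. \<Sum>i<N. h l * dd1 r (x l) * (B i l * v i))"
      unfolding sum_distrib_left by (subst sum.swap) (simp add: algebra_simps)
    also have "\<dots> = (\<Sum>l<N. h l * dd1 r (x l) * y l)"
      by (simp add: sum_distrib_left[symmetric] By)
    finally show ?thesis
      by (simp add: E0_def sum.distrib sum_subtractf algebra_simps)
  qed
  assume "\<not> ?thesis"
  then have schur: "(\<Sum>i<N. v i * E0 i)\<^sup>2 < (\<Sum>i<N. \<Sum>j<N. T0 i j * v i * v j) * (2 * b)"
    unfolding T0v E0v by simp
  have C_sym: "base_form r f x B i j = base_form r f x B j i" if "i < N" "j < N" for i j
    using B_sym[OF that] by (auto simp: base_form_def)
  have "\<forall>\<^sub>F t in at 0. \<forall>w. (\<exists>i<Suc N. w i \<noteq> 0) \<longrightarrow>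
      0 < (\<Sum>i<Suc N. \<Sum>j<Suc N. ?P t $$ (i, j) * w i * w j)"
    by (rule degenerate_form_perturbation[where C = "base_form r f x B" and v = v and c = c and ?c0.0 = "2 * b"
          and T = T and ?T0.0 = T0 and E = E and ?E0.0 = E0 and \<kappa> = \<kappa>])
      (use \<open>0 < N\<close> \<open>0 < b\<close> v0 C_sym ker \<open>\<kappa> > 0\<close> coercive bulk edge edge' corner T E c schur in auto)
  then have "\<forall>\<^sub>F t in at 0. pos_def (?P t)"
    by (simp add: pos_def_iff[OF P_sym])
  moreover have "\<forall>\<^sub>F t in at 0. op_norm (?Z t) < \<epsilon>"
  proof -
    have "((\<lambda>t. (\<Sum>i<N. (x i)\<^sup>2) + 2 * t\<^sup>2 * (\<Sum>i<N. (h i)\<^sup>2)) \<longlongrightarrow>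
        (\<Sum>i<N. (x i)\<^sup>2) + 2 * 0\<^sup>2 * (\<Sum>i<N. (h i)\<^sup>2)) (at 0)"
      by (intro tendsto_intros)
    then have "\<forall>\<^sub>F t in at 0. (\<Sum>i<N. (x i)\<^sup>2) + 2 * t\<^sup>2 * (\<Sum>i<N. (h i)\<^sup>2) < \<epsilon>\<^sup>2"
      using small by (intro order_tendstoD(2)[where a = "\<epsilon>\<^sup>2"]) auto
    then show ?thesis
    proof eventually_elim
      case (elim t)
      have "(\<Sum>i<N. \<Sum>j<N. (?Z t $$ (i, j))\<^sup>2) = (\<Sum>i<N. \<Sum>j<N. if i = j then (x i)\<^sup>2 else 0)"
        by (intro sum.cong) (auto simp: bordered_def)
      then have "(\<Sum>i<N. \<Sum>j<N. (?Z t $$ (i, j))\<^sup>2) = (\<Sum>i<N. (x i)\<^sup>2)"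
        by simp
      moreover have "?Z t $$ (i, N) = t * h i" "?Z t $$ (N, i) = t * h i" if "i < N" for i
        using that by (auto simp: bordered_def)
      moreover have "?Z t $$ (N, N) = 0"
        by (simp add: bordered_def)
      ultimately have "(\<Sum>i<Suc N. \<Sum>j<Suc N. (?Z t $$ (i, j))\<^sup>2) < \<epsilon>\<^sup>2"
        using elim by (simp add: sum.distrib sum_distrib_left power_mult_distrib algebra_simps)
      then have "sqrt (\<Sum>i<Suc N. \<Sum>j<Suc N. (?Z t $$ (i, j))\<^sup>2) < \<epsilon>"
        using \<open>\<epsilon> > 0\<close> real_less_lsqrt less_imp_le by blast
      then show ?case
        using op_norm_le_frobenius[OF bordered_carrier, of N x h t] by linarith
    qed
  qed
  ultimately have good: "\<forall>\<^sub>F t in at 0. pos_def (?P t) \<and> op_norm (?Z t) < \<epsilon>"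
    by eventually_elim simp
  moreover have "\<forall>\<^sub>F t in at 0. pos_def (?P (- t)) \<and> op_norm (?Z (- t)) < \<epsilon>"
  proof -
    have "filterlim uminus (at (0::real)) (at 0)"
      by (simp add: filterlim_at) (auto intro!: tendsto_eq_intros simp: eventually_at_filter)
    from eventually_compose_filterlim[OF good this] show ?thesis .
  qed
  ultimately have "\<forall>\<^sub>F t in at 0. (pos_def (?P t) \<and> op_norm (?Z t) < \<epsilon>) \<and>
      pos_def (?P (- t)) \<and> op_norm (?Z (- t)) < \<epsilon>"
    by eventually_elim simp
  then obtain t where "pos_def (?P t)" "op_norm (?Z t) < \<epsilon>" "pos_def (?P (- t))" "op_norm (?Z (- t)) < \<epsilon>"
    using eventually_happens'[OF at_neq_bot] by blast
  then have in_set: "?Z t \<in> ?S" "?Z (- t) \<in> ?S"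
    using bordered_sym by auto
  have "convex_mats ?S"
    using conv A unfolding matrix_convex_def by blast
  then have "(1/2) \<cdot>\<^sub>m ?Z t + (1/2) \<cdot>\<^sub>m ?Z (- t) \<in> ?S"
    unfolding convex_mats_def by (elim ballE[where x = "?Z t"] ballE[where x = "?Z (- t)"] allE[where x = "1/2"])
      (use in_set in auto)
  moreover have "(1/2) \<cdot>\<^sub>m ?Z t + (1/2) \<cdot>\<^sub>m ?Z (- t) = ?Z 0"
    by (rule eq_matI) (auto simp: bordered_def)
  ultimately have "pos_def (?P 0)"
    by simp
  then have all: "\<forall>w. (\<exists>i<Suc N. w i \<noteq> 0) \<longrightarrow> 0 < (\<Sum>i<Suc N. \<Sum>j<Suc N. ?P 0 $$ (i, j) * w i * w j)"
    by (simp only: pos_def_iff[OF P_sym])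
  have ex: "\<exists>i<Suc N. (if i < N then v i else 0) \<noteq> 0"
    using \<open>0 < N\<close> v0 by (intro exI[of _ 0]) simp
  from mp[OF spec[OF all, of "\<lambda>i. if i < N then v i else 0"] ex]
  have "0 < (\<Sum>i<Suc N. \<Sum>j<Suc N. ?P 0 $$ (i, j) * (if i < N then v i else 0) * (if j < N then v j else 0))" .
  also have "\<dots> = (\<Sum>i<N. v i * (\<Sum>j<N. base_form r f x B i j * v j))"
    by (simp add: bulk sum_distrib_left algebra_simps)
  also have "\<dots> = 0"
    by (simp add: ker)
  finally show False by simp
qed

text \<open>The degenerate block is taken to be \<open>z z\<^sup>T + |v|\<^sup>2 I - v v\<^sup>T\<close> with \<open>z\<close> orthogonal to \<open>v\<close>: the last two terms give
the kernel \<open>v\<close> and coercivity, and \<open>z\<close> is a free parameter. What matters is \<open>y = B v\<close> at the indices with \<open>v e = 0\<close>. There \<open>y e\<close>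
is explicit and can be made nonzero, while \<open>h e\<close> enters the inequality only through the product \<open>h e * y e\<close>; such an index is
a lever that adjusts both sides independently of all other data. Since \<open>y\<close> does not depend on \<open>h\<close> or \<open>b\<close>, these may be
chosen after \<open>y\<close> is known.\<close>

lemma curvature_inequality:
  fixes r f :: "real poly" and \<epsilon> :: real and N :: nat and x v z :: "nat \<Rightarrow> real"
  assumes conv: "matrix_convex r f \<epsilon>"
    and r_0: "poly r 0 = 1" and f_0: "poly f 0 = 0"
    and "0 < N" and v0: "v 0 \<noteq> 0"
    and orth: "(\<Sum>i<N. z i * v i) = 0"
    and r_pos: "\<And>i. i < N \<Longrightarrow> 0 < poly r (x i)"
    and small: "(\<Sum>i<N. (x i)\<^sup>2) < \<epsilon>\<^sup>2" and "\<epsilon> > 0"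
  obtains y where
    "\<And>e. e < N \<Longrightarrow> v e = 0 \<Longrightarrow> y e = z e * (\<Sum>j<N. z j * v j / (poly r (x e) + poly r (x j)))"
    "\<And>h b. 0 < b \<Longrightarrow>
      (2 * (\<Sum>i<N. \<Sum>j<N. v i * h i * dd2 r (x i) (x j) * h j * y j)
        - 2 * (\<Sum>i<N. \<Sum>j<N. v i * h i * dd2 f (x i) (x j) * h j * v j)) * (2 * b)
      \<le> (\<Sum>i<N. dd1 r (x i) * h i * (b * v i + y i) - 2 * dd1 f (x i) * h i * v i)\<^sup>2"
proof -
  define V where "V = (\<Sum>i<N. (v i)\<^sup>2)"
  define C where "C i j = z i * z j + (if i = j then V else 0) - v i * v j" for i j
  define B where "B i j = (C i j + (if i = j then 2 * poly f (x i) else 0)) / (poly r (x i) + poly r (x j))" for i j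
  define y where "y i = (\<Sum>j<N. B i j * v j)" for i
  have base: "base_form r f x B i j = C i j" if "i < N" "j < N" for i j
  proof -
    have "0 < poly r (x i) + poly r (x j)"
      using r_pos[OF that(1)] r_pos[OF that(2)] by simp
    then show ?thesis by (simp add: base_form_def B_def)
  qed
  have C_sym: "C i j = C j i" for i j
    by (simp add: C_def)
  have B_sym: "B i j = B j i" for i j
    unfolding B_def using C_sym[of i j] by (simp add: add.commute)
  have ker: "(\<Sum>j<N. base_form r f x B i j * v j) = 0" if i: "i < N" for i
  proof -
    have "(\<Sum>j<N. base_form r f x B i j * v j) = (\<Sum>j<N. C i j * v j)"
      by (rule sum.cong) (use i base in auto)
    also have "\<dots> = z i * (\<Sum>j<N. z j * v j) + (\<Sum>j<N. if i = j then V * v i else 0) - v i * V"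
      unfolding C_def V_def power2_eq_square sum_distrib_left sum.distrib[symmetric] sum_subtractf[symmetric]
      by (rule sum.cong) (auto simp: algebra_simps)
    also have "\<dots> = 0"
      using i orth by simp
    finally show ?thesis .
  qed
  have coercive: "(v 0)\<^sup>2 * (\<Sum>i<N. (u i)\<^sup>2) \<le> (\<Sum>i<N. \<Sum>j<N. base_form r f x B i j * u i * u j)"
    if u0: "u 0 = 0" for u
  proof -
    define w where "w i = (if i = 0 then 0 else v i)" for i :: nat
    have V: "V = (v 0)\<^sup>2 + (\<Sum>i<N. (w i)\<^sup>2)"
    proof -
      have "{..<N} = insert 0 {1..<N}"
        using \<open>0 < N\<close> by auto
      then show ?thesis
        by (simp add: V_def w_def)
    qed
    have "(\<Sum>i<N. v i * u i) = (\<Sum>i<N. w i * u i)"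
      by (rule sum.cong) (auto simp: w_def u0)
    then have cs: "(\<Sum>i<N. v i * u i)\<^sup>2 \<le> (\<Sum>i<N. (w i)\<^sup>2) * (\<Sum>i<N. (u i)\<^sup>2)"
      using Cauchy_Schwarz_ineq_sum[of w u "{..<N}"] by simp
    have square: "(\<Sum>i<N. \<Sum>j<N. a i * a j) = (\<Sum>i<N. a i)\<^sup>2" for a :: "nat \<Rightarrow> real"
      by (simp only: power2_eq_square sum_product)
    have "(\<Sum>i<N. \<Sum>j<N. base_form r f x B i j * u i * u j) = (\<Sum>i<N. \<Sum>j<N. C i j * u i * u j)"
      by (intro sum.cong) (use base in auto)
    also have "\<dots> = (\<Sum>i<N. \<Sum>j<N. (z i * u i) * (z j * u j) + (if i = j then V * (u i)\<^sup>2 else 0)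
        - (v i * u i) * (v j * u j))"
      by (intro sum.cong) (auto simp: C_def algebra_simps power2_eq_square)
    also have "\<dots> = (\<Sum>i<N. z i * u i)\<^sup>2 + V * (\<Sum>i<N. (u i)\<^sup>2) - (\<Sum>i<N. v i * u i)\<^sup>2"
      unfolding sum.distrib sum_subtractf square by (simp add: sum_distrib_left)
    also have "\<dots> \<ge> V * (\<Sum>i<N. (u i)\<^sup>2) - (\<Sum>i<N. (w i)\<^sup>2) * (\<Sum>i<N. (u i)\<^sup>2)"
      using cs zero_le_power2[of "\<Sum>i<N. z i * u i"] by linarith
    finally show ?thesis
      by (simp add: V algebra_simps)
  qed
  have "y e = z e * (\<Sum>j<N. z j * v j / (poly r (x e) + poly r (x j)))" if "e < N" "v e = 0" for e
    unfolding y_def sum_distrib_left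
    by (rule sum.cong) (use that in \<open>auto simp: B_def C_def\<close>)
  moreover have "(2 * (\<Sum>i<N. \<Sum>j<N. v i * h i * dd2 r (x i) (x j) * h j * y j)
        - 2 * (\<Sum>i<N. \<Sum>j<N. v i * h i * dd2 f (x i) (x j) * h j * v j)) * (2 * b)
      \<le> (\<Sum>i<N. dd1 r (x i) * h i * (b * v i + y i) - 2 * dd1 f (x i) * h i * v i)\<^sup>2"
    if "0 < b" for h b
    unfolding y_def
    by (rule curvature_test[OF conv r_0 f_0 that \<open>0 < N\<close> v0 B_sym ker _ coercive small \<open>\<epsilon> > 0\<close>])
      (use v0 in auto)
  ultimately show thesis
    using that by blast
qed

section \<open>Bounds on the degrees\<close>

lemma pair_coeffs_pCons:
  "pair_coeffs (pCons a q) w = a * w 0 + pair_coeffs q (\<lambda>m. w (Suc m))"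
proof (cases "q = 0")
  case False
  then show ?thesis
    unfolding pair_coeffs_def by (simp add: sum.atMost_Suc_shift del: sum.atMost_Suc)
qed (auto simp: pair_coeffs_def)

lemma dd1_pCons: "dd1 (pCons a q) x = poly q x"
  by (simp add: dd1_def pair_coeffs_pCons pair_coeffs_power)

lemma dd2_zero_pCons: "dd2 (pCons a (pCons b q)) 0 y = poly q y"
proof -
  have "(\<Sum>a\<le>m. 0 ^ a * y ^ (m - a)) = y ^ m" for m
  proof -
    have "(\<Sum>a\<le>m. 0 ^ a * y ^ (m - a)) = (\<Sum>a\<le>m. if a = 0 then y ^ m else 0)"
      by (rule sum.cong) (auto simp: power_0_left)
    then show ?thesis by simp
  qed
  then have "quot2 (Suc (Suc m)) 0 y = y ^ m" for m
    by (simp only: quot2_eq_sum)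
  moreover have "quot2 (Suc 0) 0 y = 0"
    by simp
  ultimately show ?thesis
    by (simp add: dd2_def pair_coeffs_pCons pair_coeffs_power del: quot2.simps(2))
qed

lemma dd2_linear: "dd2 [:a, b:] x y = 0"
  by (simp add: dd2_def pair_coeffs_pCons pair_coeffs_def)

lemma exists_small_nonroot:
  fixes q :: "real poly"
  assumes "q \<noteq> 0" "\<delta> > 0"
  obtains x where "0 < x" "x < \<delta>" "poly q x \<noteq> 0"
proof -
  have "infinite {0<..<\<delta>}"
    using \<open>\<delta> > 0\<close> by (simp add: infinite_Ioo)
  then have "\<not> {0<..<\<delta>} \<subseteq> {x. poly q x = 0}"
    using poly_roots_finite[OF \<open>q \<noteq> 0\<close>] finite_subset by blast
  then obtain x where "x \<in> {0<..<\<delta>}" "poly q x \<noteq> 0"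
    by blast
  then show thesis using that[of x] by simp
qed

lemma positive_near_zero:
  fixes q :: "real poly"
  assumes "poly q 0 > 0"
  obtains \<delta> where "\<delta> > 0" "\<And>x. \<bar>x\<bar> < \<delta> \<Longrightarrow> poly q x > 0"
proof -
  have "((\<lambda>x. poly q x) \<longlongrightarrow> poly q 0) (at 0)"
    by (rule isContD) simp
  then have "\<forall>\<^sub>F x in at 0. poly q x > 0"
    using assms by (rule order_tendstoD)
  then obtain d where d: "d > 0" "\<And>x. x \<noteq> 0 \<Longrightarrow> dist x 0 < d \<Longrightarrow> poly q x > 0"
    by (auto simp: eventually_at)
  show thesis
    by (rule that[of d]) (use d assms in \<open>auto, metis dist_0_norm dist_commute real_norm_def\<close>)
qed

lemma reciprocals_differ:
  fixes a b c :: real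
  assumes "0 < a + b" "0 < a + c" "b \<noteq> c"
  shows "1 / (a + b) - 1 / (a + c) \<noteq> 0"
  using assms by (simp add: inverse_eq_divide[symmetric])

text \<open>Write \<open>r = 1 + x R\<close> and \<open>R = r1 + x S\<close>. The vector \<open>v\<close> lives on the points 0 and \<open>x1\<close>, and only the point 0 is coupled to the
border among these two. Two further points \<open>e1, e2\<close> outside the support of \<open>v\<close> contribute \<open>R e1 * \<beta>1 + R e2 * \<beta>2\<close> to the border
and \<open>S e1 * \<beta>1 + S e2 * \<beta>2\<close> to the curvature, with \<open>\<beta>1, \<beta>2\<close> arbitrary. If \<open>S\<close> is not 0, it is not proportional to \<open>R\<close>, whose
degree is larger, so the two contributions can be prescribed separately, and the curvature inequality fails.\<close>

lemma degree_r_le_1: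
  assumes conv: "matrix_convex r f \<epsilon>" and "\<epsilon> > 0"
    and r_0: "poly r 0 = 1" and f_0: "poly f 0 = 0"
  shows "degree r \<le> 1"
proof (rule ccontr)
  assume deg: "\<not> degree r \<le> 1"
  obtain r1 S where r: "r = pCons 1 (pCons r1 S)"
    using r_0 by (metis pCons_cases poly_pCons mult_zero_left add.right_neutral)
  define R where "R = pCons r1 S"
  have S: "S \<noteq> 0"
    using deg degree_pCons_le[of 1 "[:r1:]"] by (auto simp: r)
  obtain \<delta>0 where \<delta>0: "\<delta>0 > 0" "\<And>x. \<bar>x\<bar> < \<delta>0 \<Longrightarrow> poly r x > 0"
    using positive_near_zero[of r] r_0 by auto
  define \<delta> where "\<delta> = min \<delta>0 (\<epsilon> / 2)"
  have \<delta>: "\<delta> > 0" "\<delta> \<le> \<delta>0" "\<delta> \<le> \<epsilon> / 2"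
    using \<delta>0 \<open>\<epsilon> > 0\<close> by (auto simp: \<delta>_def)
  have "r - 1 \<noteq> 0"
    using S by (simp add: r one_pCons)
  \<comment> \<open>A value of \<open>r\<close> other than \<open>r 0\<close> makes \<open>y\<close> nonzero at \<open>e1\<close> and \<open>e2\<close>.\<close>
  then obtain x1 where x1: "0 < x1" "x1 < \<delta>" "poly (r - 1) x1 \<noteq> 0"
    using exists_small_nonroot \<delta>(1) by blast
  obtain e2 where e2: "0 < e2" "e2 < \<delta>" "poly S e2 \<noteq> 0"
    using exists_small_nonroot[OF S \<delta>(1)] by blast
  \<comment> \<open>The determinant of the linear system for \<open>\<beta>1, \<beta>2\<close>, as a polynomial in \<open>e1\<close>.\<close>
  define G where "G = smult (poly S e2) R - smult (poly R e2) S"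
  have "G \<noteq> 0"
  proof
    assume "G = 0"
    then have "degree (smult (poly S e2) R) = degree (smult (poly R e2) S)"
      by (simp add: G_def)
    then show False
      using e2(3) S degree_smult_le[of "poly R e2" S] by (simp add: R_def)
  qed
  then obtain e1 where e1: "0 < e1" "e1 < \<delta>" "poly G e1 \<noteq> 0"
    using exists_small_nonroot \<delta>(1) by blast
  define x where "x i = [0, x1, e1, e2] ! i" for i
  define v where "v i = [1, 1, 0, 0 :: real] ! i" for i
  define z where "z i = [1, -1, 1, 1 :: real] ! i" for i
  have sum4: "(\<Sum>i<4. g i) = g 0 + g 1 + g 2 + g 3" for g :: "nat \<Rightarrow> real"
    by (simp add: numeral_eq_Suc)
  have r_pos: "0 < poly r (x i)" if "i < 4" for i
  proof -
    have "i = 0 \<or> i = 1 \<or> i = 2 \<or> i = 3"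
      using that by auto
    then show ?thesis
      using \<delta>0(2)[of "x i"] \<delta> x1 e1 e2 r_0 by (auto simp: x_def)
  qed
  have "e\<^sup>2 \<le> \<epsilon>\<^sup>2 / 4" if "0 < e" "e < \<delta>" for e
    using power_mono[of e "\<epsilon> / 2" 2] that \<delta> by (simp add: power_divide)
  from this[OF x1(1,2)] this[OF e1(1,2)] this[OF e2(1,2)]
  have "x1\<^sup>2 + e1\<^sup>2 + e2\<^sup>2 < \<epsilon>\<^sup>2"
    using zero_less_power[OF \<open>\<epsilon> > 0\<close>, of 2] by linarith
  then have small: "(\<Sum>i<4. (x i)\<^sup>2) < \<epsilon>\<^sup>2"
    by (simp add: sum4 x_def)
  obtain y where
    y: "\<And>e. e < 4 \<Longrightarrow> v e = 0 \<Longrightarrow> y e = z e * (\<Sum>j<4. z j * v j / (poly r (x e) + poly r (x j)))"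
    and test: "\<And>h b. 0 < b \<Longrightarrow>
      (2 * (\<Sum>i<4. \<Sum>j<4. v i * h i * dd2 r (x i) (x j) * h j * y j)
        - 2 * (\<Sum>i<4. \<Sum>j<4. v i * h i * dd2 f (x i) (x j) * h j * v j)) * (2 * b)
      \<le> (\<Sum>i<4. dd1 r (x i) * h i * (b * v i + y i) - 2 * dd1 f (x i) * h i * v i)\<^sup>2"
  proof (rule curvature_inequality[OF conv r_0 f_0, where N = 4 and v = v and z = z and x = x], goal_cases)
    case (7 y)
    show thesis by (rule 7(1)[of y]) (fact 7)+
  qed (use r_pos small \<open>\<epsilon> > 0\<close> in \<open>auto simp: sum4 v_def z_def\<close>)
  have y_nz: "y e \<noteq> 0" if "e = 2 \<or> e = 3" for e
  proof -
    have p: "0 < poly r (x e)" "0 < poly r x1"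
      using r_pos[of e] r_pos[of 1] that by (auto simp: x_def)
    have "y e = 1 / (poly r (x e) + 1) - 1 / (poly r (x e) + poly r x1)"
      using y[of e] that r_0 by (auto simp: sum4 v_def z_def x_def)
    also have "\<dots> \<noteq> 0"
      using p x1(3) by (intro reciprocals_differ) auto
    finally show ?thesis .
  qed
  define D where "D = poly R e1 * poly S e2 - poly R e2 * poly S e1"
  have D: "D \<noteq> 0"
    using e1(3) by (simp add: G_def D_def mult.commute)
  \<comment> \<open>Cramer's rule makes the border term vanish while the curvature term becomes 2.\<close>
  define p where "p = 2 * dd1 f 0 - dd1 r 0 * (1 + y 0)"
  define q where "q = 1 + dd2 f 0 0 - dd2 r 0 0 * y 0"
  define \<beta>1 where "\<beta>1 = (p * poly S e2 - q * poly R e2) / D"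
  define \<beta>2 where "\<beta>2 = (q * poly R e1 - p * poly S e1) / D"
  have \<beta>: "poly R e1 * \<beta>1 + poly R e2 * \<beta>2 = p" "poly S e1 * \<beta>1 + poly S e2 * \<beta>2 = q"
  proof -
    have "poly R e1 * \<beta>1 + poly R e2 * \<beta>2 = p * D / D"
      unfolding \<beta>1_def \<beta>2_def by (simp add: D_def add_divide_distrib[symmetric] algebra_simps)
    then show "poly R e1 * \<beta>1 + poly R e2 * \<beta>2 = p" using D by simp
    have "poly S e1 * \<beta>1 + poly S e2 * \<beta>2 = q * D / D"
      unfolding \<beta>1_def \<beta>2_def by (simp add: D_def add_divide_distrib[symmetric] algebra_simps)
    then show "poly S e1 * \<beta>1 + poly S e2 * \<beta>2 = q" using D by simp
  qed
  define h where "h i = [1, 0, \<beta>1 / y 2, \<beta>2 / y 3] ! i" for i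
  have hy: "h 2 * y 2 = \<beta>1" "h 3 * y 3 = \<beta>2"
    using y_nz by (auto simp: h_def)
  have h01: "h 0 = 1" "h 1 = 0"
    by (auto simp: h_def)
  have v: "v 0 = 1" "v 1 = 1" "v 2 = 0" "v 3 = 0"
    by (auto simp: v_def)
  have x: "x 0 = 0" "x 1 = x1" "x 2 = e1" "x 3 = e2"
    by (auto simp: x_def)
  have dd: "dd1 r t = poly R t" "dd2 r 0 t = poly S t" for t
    unfolding r R_def by (simp_all only: dd1_pCons dd2_zero_pCons)
  have "(\<Sum>i<4. \<Sum>j<4. v i * h i * dd2 r (x i) (x j) * h j * y j) =
      dd2 r 0 0 * y 0 + (poly S e1 * (h 2 * y 2) + poly S e2 * (h 3 * y 3))"
    unfolding sum4 v h01 x dd by simp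
  moreover have "(\<Sum>i<4. \<Sum>j<4. v i * h i * dd2 f (x i) (x j) * h j * v j) = dd2 f 0 0"
    unfolding sum4 v h01 x by simp
  moreover have "(\<Sum>i<4. dd1 r (x i) * h i * (1 * v i + y i) - 2 * dd1 f (x i) * h i * v i) =
      dd1 r 0 * (1 + y 0) - 2 * dd1 f 0 + (poly R e1 * (h 2 * y 2) + poly R e2 * (h 3 * y 3))"
    unfolding sum4 v h01 x dd by simp
  ultimately show False
    using test[of 1 h] unfolding hy \<beta> by (simp add: p_def q_def)
qed

text \<open>For \<open>r = 1 + r1 x\<close> the second divided difference of \<open>r\<close> vanishes, and the curvature is \<open>-2\<close> times the quadratic form of
\<open>f\<close>. If \<open>r1\<close> is not 0, a single lever index \<open>M\<close> cancels the border term. If \<open>r1 = 0\<close>, the border term does not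
depend on \<open>b\<close>, and letting \<open>b\<close> grow makes it negligible. The equidistant nodes prepare for finite differences.\<close>

lemma curvature_kernel_psd:
  assumes conv: "matrix_convex [:1, r1:] f \<epsilon>" and "\<epsilon> > 0" and f_0: "poly f 0 = 0"
  obtains s where "s > 0"
    "\<And>\<omega>. 0 \<le> (\<Sum>i<n + 2. \<Sum>j<n + 2. \<omega> i * \<omega> j * dd2 f (real i * s) (real j * s))"
proof -
  let ?r = "[:1, r1:]"
  define M where "M = n + 2"
  obtain \<delta> where \<delta>: "\<delta> > 0" "\<And>x. \<bar>x\<bar> < \<delta> \<Longrightarrow> poly ?r x > 0"
    using positive_near_zero[of ?r] by auto
  define K where "K = real (Suc M)"
  have K: "K > 1" by (simp add: K_def M_def)
  \<comment> \<open>The nodes stay below \<open>min \<delta> \<epsilon> / K\<close>, and there are \<open>K\<close> of them, so their squares sum to at most \<open>\<epsilon>\<^sup>2 / K\<close>.\<close>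
  define s where "s = min \<delta> \<epsilon> / K\<^sup>2"
  have s: "s > 0" "K * s = min \<delta> \<epsilon> / K"
    using \<delta>(1) \<open>\<epsilon> > 0\<close> K by (auto simp: s_def power2_eq_square)
  have Ks: "K * s < \<delta>" "K * s \<le> \<epsilon> / K"
  proof -
    have "min \<delta> \<epsilon> / K < min \<delta> \<epsilon>"
      using divide_strict_left_mono[of 1 K "min \<delta> \<epsilon>"] K \<delta>(1) \<open>\<epsilon> > 0\<close> by simp
    then show "K * s < \<delta>" using s(2) by linarith
    show "K * s \<le> \<epsilon> / K"
      unfolding s(2) using K by (intro divide_right_mono) auto
  qed
  define x where "x i = (if i < M then real i * s else 0)" for i
  define v :: "nat \<Rightarrow> real" where "v i = (if i < M then 1 else 0)" for i
  define z :: "nat \<Rightarrow> real" where "z i = (if i = 1 then -1 else if i = 0 \<or> i = M then 1 else 0)" for i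
  have x_bound: "0 \<le> x i" "x i \<le> K * s" for i
    using s(1) by (auto simp: x_def K_def intro: mult_right_mono)
  have r_pos: "0 < poly ?r (x i)" for i
    using \<delta>(2)[of "x i"] x_bound[of i] Ks(1) by simp
  have small: "(\<Sum>i<Suc M. (x i)\<^sup>2) < \<epsilon>\<^sup>2"
  proof -
    have "(\<Sum>i<Suc M. (x i)\<^sup>2) \<le> (\<Sum>i<Suc M. (\<epsilon> / K)\<^sup>2)"
      by (intro sum_mono power_mono) (use x_bound Ks(2) order_trans in blast)+
    also have "\<dots> = \<epsilon>\<^sup>2 / K"
      using K by (simp add: K_def power_divide power2_eq_square)
    also have "\<dots> < \<epsilon>\<^sup>2"
      using K \<open>\<epsilon> > 0\<close> by (simp add: divide_less_eq)
    finally show ?thesis .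
  qed
  have M_split: "(\<Sum>i<M. g i) = g 0 + g 1 + (\<Sum>i<n. g (i + 2))" for g :: "nat \<Rightarrow> real"
    unfolding M_def by (simp add: sum.lessThan_Suc_shift del: sum.lessThan_Suc)
  have orth: "(\<Sum>i<Suc M. z i * v i) = 0"
  proof -
    have "z (i + 2) = 0" if "i < n" for i
      using that by (simp add: z_def M_def)
    then have "(\<Sum>i<M. z i * v i) = z 0 * v 0 + z 1 * v 1"
      by (simp add: M_split)
    then show ?thesis by (simp add: z_def v_def M_def)
  qed
  obtain y where
    y: "\<And>e. e < Suc M \<Longrightarrow> v e = 0 \<Longrightarrow>
      y e = z e * (\<Sum>j<Suc M. z j * v j / (poly ?r (x e) + poly ?r (x j)))"
    and test: "\<And>h b. 0 < b \<Longrightarrow>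
      (2 * (\<Sum>i<Suc M. \<Sum>j<Suc M. v i * h i * dd2 ?r (x i) (x j) * h j * y j)
        - 2 * (\<Sum>i<Suc M. \<Sum>j<Suc M. v i * h i * dd2 f (x i) (x j) * h j * v j)) * (2 * b)
      \<le> (\<Sum>i<Suc M. dd1 ?r (x i) * h i * (b * v i + y i) - 2 * dd1 f (x i) * h i * v i)\<^sup>2"
  proof (rule curvature_inequality[OF conv _ f_0, where N = "Suc M" and v = v and z = z and x = x], goal_cases)
    case (8 y)
    show thesis by (rule 8(1)[of y]) (fact 8)+
  qed (use r_pos orth small \<open>\<epsilon> > 0\<close> in \<open>auto simp: v_def M_def\<close>)
  have "0 \<le> (\<Sum>i<M. \<Sum>j<M. \<omega> i * \<omega> j * dd2 f (real i * s) (real j * s))" for \<omega>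
  proof -
    define Q where "Q = (\<Sum>i<M. \<Sum>j<M. \<omega> i * \<omega> j * dd2 f (real i * s) (real j * s))"
    define L where "L b = (\<Sum>i<M. r1 * \<omega> i * (b + y i) - 2 * dd1 f (x i) * \<omega> i)" for b
    have dd1_r: "dd1 ?r t = r1" for t
      by (simp add: dd1_pCons)
    have key: "- 2 * Q * (2 * b) \<le> (L b + r1 * H * y M)\<^sup>2" if "0 < b" for b H
    proof -
      define h where "h i = (if i < M then \<omega> i else H)" for i
      have "(\<Sum>i<Suc M. \<Sum>j<Suc M. v i * h i * dd2 f (x i) (x j) * h j * v j) =
          (\<Sum>i<M. \<Sum>j<M. v i * h i * dd2 f (x i) (x j) * h j * v j)"
        by (simp add: v_def)
      also have "\<dots> = Q"
        unfolding Q_def by (intro sum.cong) (auto simp: v_def h_def x_def)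
      moreover have "(\<Sum>i<Suc M. dd1 ?r (x i) * h i * (b * v i + y i) - 2 * dd1 f (x i) * h i * v i)
          = L b + r1 * H * y M"
        by (simp add: L_def v_def h_def dd1_r)
      ultimately show ?thesis
        using test[OF that, of h] by (simp add: dd2_linear)
    qed
    have "0 \<le> Q"
    proof (cases "r1 = 0")
      case True
      show ?thesis
      proof (rule ccontr)
        assume "\<not> 0 \<le> Q"
        define b where "b = ((L 1)\<^sup>2 + 1) / (- 4 * Q)"
        have "b > 0"
          using \<open>\<not> 0 \<le> Q\<close> unfolding b_def by (intro divide_pos_pos) (auto simp: add_nonneg_pos)
        moreover have "- 2 * Q * (2 * b) = (L 1)\<^sup>2 + 1"
          using \<open>\<not> 0 \<le> Q\<close> by (simp add: b_def field_simps)
        moreover have "L b = L 1"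
          by (simp add: L_def True)
        ultimately show False
          using key[of b 0] by (simp add: True)
      qed
    next
      case False
      have "y M = 1 / (1 + 1) - 1 / (1 + poly ?r s)"
        using y[of M] unfolding sum.lessThan_Suc M_split by (simp add: z_def v_def x_def M_def)
      also have "\<dots> \<noteq> 0"
        using r_pos[of 1] s(1) False by (intro reciprocals_differ) (auto simp: x_def M_def)
      finally have "y M \<noteq> 0" .
      then show ?thesis
        using key[of 1 "- L 1 / (r1 * y M)"] False by simp
    qed
    then show ?thesis by (simp add: Q_def)
  qed
  then show thesis
    using that[of s] s(1) by (simp add: M_def)
qed

text \<open>The \<open>n\<close>-th finite difference of \<open>x ^ a\<close> at 0, up to sign. The induction absorbs one factor \<open>i\<close> into the
binomial coefficient and expands \<open>(i + 1) ^ k\<close>.\<close>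

lemma alternating_power_sum:
  "a \<le> n \<Longrightarrow> (\<Sum>i\<le>n. (-1) ^ i * real (n choose i) * real i ^ a) = (if a = n then (-1) ^ n * fact n else 0)"
proof (induction n arbitrary: a)
  case (Suc n)
  show ?case
  proof (cases a)
    case 0
    then show ?thesis
      using choose_alternating_sum[of "Suc n", where 'a = real] by simp
  next
    case (Suc k)
    have k: "k \<le> n"
      using Suc Suc.prems by simp
    have "(\<Sum>i\<le>Suc n. (-1) ^ i * real (Suc n choose i) * real i ^ a) =
        (\<Sum>i\<le>n. (-1) ^ Suc i * real (Suc n choose Suc i) * real (Suc i) ^ a)"
      by (subst sum.atMost_Suc_shift) (simp add: Suc)
    also have "\<dots> = (\<Sum>i\<le>n. \<Sum>b\<le>k. - real (Suc n) * real (k choose b) * ((-1) ^ i * real (n choose i) * real i ^ b))"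
    proof (rule sum.cong[OF refl])
      fix i
      have absorb: "Suc i * (Suc n choose Suc i) = Suc n * (n choose i)"
        using Suc_times_binomial_eq[of n i] by (simp only: mult.commute)
      have "(-1) ^ Suc i * real (Suc n choose Suc i) * real (Suc i) ^ a =
          (-1) ^ Suc i * real (Suc i * (Suc n choose Suc i)) * real (Suc i) ^ k"
        by (simp add: Suc algebra_simps del: binomial_Suc_Suc)
      also have "\<dots> = (-1) ^ Suc i * real (Suc n * (n choose i)) * real (Suc i) ^ k"
        by (simp only: absorb)
      also have "real (Suc i) ^ k = (\<Sum>b\<le>k. real (k choose b) * real i ^ b)"
        using binomial_ring[of "real i" 1 k] by (simp add: add.commute)
      also have "(-1) ^ Suc i * real (Suc n * (n choose i)) * (\<Sum>b\<le>k. real (k choose b) * real i ^ b) =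
          (\<Sum>b\<le>k. - real (Suc n) * real (k choose b) * ((-1) ^ i * real (n choose i) * real i ^ b))"
        unfolding sum_distrib_left by (intro sum.cong refl) (simp add: algebra_simps)
      finally show "(-1) ^ Suc i * real (Suc n choose Suc i) * real (Suc i) ^ a =
          (\<Sum>b\<le>k. - real (Suc n) * real (k choose b) * ((-1) ^ i * real (n choose i) * real i ^ b))" .
    qed
    also have "\<dots> = (\<Sum>b\<le>k. - real (Suc n) * real (k choose b) * (\<Sum>i\<le>n. (-1) ^ i * real (n choose i) * real i ^ b))"
      unfolding sum_distrib_left by (rule sum.swap)
    also have "\<dots> = (\<Sum>b\<le>k. if b = n then - real (Suc n) * ((-1) ^ n * fact n) else 0)"
      using Suc.IH k by (intro sum.cong) (auto simp: antisym)
    also have "\<dots> = (if a = Suc n then (-1) ^ Suc n * fact (Suc n) else 0)"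
      using k Suc by (auto simp: algebra_simps)
    finally show ?thesis .
  qed
qed simp

text \<open>The kernel \<open>f[x, 0, y]\<close> is a Hankel form in disguise: it sees the weights \<open>\<omega>\<close> only through their moments, and
the moments \<open>a, b\<close> are paired with the coefficient \<open>a + b + 2\<close> of the polynomial.\<close>

lemma dd2_moments:
  fixes x \<omega> :: "nat \<Rightarrow> real" and M :: nat
  defines "\<mu> \<equiv> \<lambda>a. \<Sum>i<M. \<omega> i * x i ^ a"
  shows "(\<Sum>i<M. \<Sum>j<M. \<omega> i * \<omega> j * dd2 q (x i) (x j)) =
    pair_coeffs q (\<lambda>m. if m < 2 then 0 else \<Sum>a\<le>m - 2. \<mu> a * \<mu> (m - 2 - a))"
proof -
  have weight: "(\<Sum>i<M. \<Sum>j<M. \<omega> i * \<omega> j * quot2 m (x i) (x j)) =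
      (if m < 2 then 0 else \<Sum>a\<le>m - 2. \<mu> a * \<mu> (m - 2 - a))" for m
  proof (cases "m < 2")
    case True
    then have "m = 0 \<or> m = 1" by auto
    then show ?thesis by auto
  next
    case False
    then obtain k where m: "m = Suc (Suc k)"
      by (metis One_nat_def Suc_1 less_2_cases_iff not0_implies_Suc)
    have "(\<Sum>i<M. \<Sum>j<M. \<omega> i * \<omega> j * quot2 m (x i) (x j)) =
        (\<Sum>i<M. \<Sum>j<M. \<Sum>a\<le>k. (\<omega> i * x i ^ a) * (\<omega> j * x j ^ (k - a)))"
      unfolding m quot2_eq_sum sum_distrib_left by (intro sum.cong refl) (simp add: mult_ac)
    also have "\<dots> = (\<Sum>i<M. \<Sum>a\<le>k. \<Sum>j<M. (\<omega> i * x i ^ a) * (\<omega> j * x j ^ (k - a)))"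
      by (intro sum.cong refl sum.swap)
    also have "\<dots> = (\<Sum>a\<le>k. \<Sum>i<M. \<Sum>j<M. (\<omega> i * x i ^ a) * (\<omega> j * x j ^ (k - a)))"
      by (rule sum.swap)
    also have "\<dots> = (\<Sum>a\<le>k. \<mu> a * \<mu> (k - a))"
      by (simp only: \<mu>_def sum_product)
    finally show ?thesis by (simp add: m)
  qed
  have "(\<Sum>i<M. \<Sum>j<M. \<omega> i * \<omega> j * dd2 q (x i) (x j)) =
      (\<Sum>i<M. \<Sum>j<M. \<Sum>m\<le>degree q. coeff q m * (\<omega> i * \<omega> j * quot2 m (x i) (x j)))"
    unfolding dd2_def pair_coeffs_def sum_distrib_left by (intro sum.cong refl) (simp add: mult_ac)
  also have "\<dots> = (\<Sum>i<M. \<Sum>m\<le>degree q. \<Sum>j<M. coeff q m * (\<omega> i * \<omega> j * quot2 m (x i) (x j)))"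
    by (intro sum.cong refl sum.swap)
  also have "\<dots> = (\<Sum>m\<le>degree q. \<Sum>i<M. \<Sum>j<M. coeff q m * (\<omega> i * \<omega> j * quot2 m (x i) (x j)))"
    by (rule sum.swap)
  finally show ?thesis
    by (simp only: pair_coeffs_def weight sum_distrib_left[symmetric])
qed

text \<open>Let \<open>n + 2\<close> be the degree of \<open>f\<close>. Finite difference weights plus a point mass \<open>\<sigma>\<close> at 0 have only two nonzero moments
up to order \<open>n\<close>, namely \<open>\<sigma>\<close> in order 0 and some \<open>\<beta> \<noteq> 0\<close> in order \<open>n\<close>. For \<open>n \<ge> 1\<close> the entry of the Hankel
matrix at \<open>(n, n)\<close> is a coefficient beyond the degree, hence 0, while the one at \<open>(0, n)\<close> is the leading coefficient, so
the form is indefinite.\<close>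

lemma degree_le_2_if_kernels_psd:
  assumes psd: "\<And>n. \<exists>s>0. \<forall>\<omega>. 0 \<le> (\<Sum>i<n + 2. \<Sum>j<n + 2. \<omega> i * \<omega> j * dd2 f (real i * s) (real j * s))"
  shows "degree f \<le> 2"
proof (rule ccontr)
  assume "\<not> degree f \<le> 2"
  then obtain n where n: "degree f = Suc (Suc n)" "n \<ge> 1"
    by (metis One_nat_def Suc_1 Suc_le_mono bot_nat_0.extremum not0_implies_Suc not_less_eq_eq)
  obtain s where s: "s > 0" and
    psd': "\<And>\<omega>. 0 \<le> (\<Sum>i<n + 2. \<Sum>j<n + 2. \<omega> i * \<omega> j * dd2 f (real i * s) (real j * s))"
    using psd[of n] by blast
  define c where "c = coeff f (degree f)"
  define \<beta> where "\<beta> = s ^ n * ((-1) ^ n * fact n)"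
  have "f \<noteq> 0"
    using n by auto
  then have c: "c * \<beta> \<noteq> 0"
    using s by (simp add: c_def \<beta>_def)
  have parabola: "0 \<le> coeff f 2 * \<sigma>\<^sup>2 + 2 * (c * \<beta>) * \<sigma>" for \<sigma>
  proof -
    define \<omega> where "\<omega> i = (if i = 0 then \<sigma> else 0) + (-1) ^ i * real (n choose i)" for i
    define \<mu> where "\<mu> a = (\<Sum>i<n + 2. \<omega> i * (real i * s) ^ a)" for a
    have \<mu>: "\<mu> a = (if a = 0 then \<sigma> else if a = n then \<beta> else 0)" if "a \<le> n" for a
    proof -
      have "\<mu> a = (\<Sum>i<n + 2. if i = 0 then \<sigma> * 0 ^ a else 0) +
          s ^ a * (\<Sum>i<n + 2. (-1) ^ i * real (n choose i) * real i ^ a)"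
        unfolding \<mu>_def \<omega>_def sum_distrib_left sum.distrib[symmetric]
        by (intro sum.cong refl, cases a) (auto simp: algebra_simps power_mult_distrib)
      also have "(\<Sum>i<n + 2. (-1) ^ i * real (n choose i) * real i ^ a) =
          (\<Sum>i\<le>n. (-1) ^ i * real (n choose i) * real i ^ a)"
        by (simp add: lessThan_Suc_atMost[symmetric])
      also have "\<dots> = (if a = n then (-1) ^ n * fact n else 0)"
        by (rule alternating_power_sum[OF that])
      finally show ?thesis
        using n(2) by (cases a) (auto simp: \<beta>_def)
    qed
    have weight: "(\<Sum>a\<le>k. \<mu> a * \<mu> (k - a)) = (if k = 0 then \<sigma>\<^sup>2 else if k = n then 2 * \<beta> * \<sigma> else 0)"
      if "k \<le> n" for k
    proof (cases "k = 0")
      case True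
      then show ?thesis by (simp add: \<mu> power2_eq_square)
    next
      case False
      have "(\<Sum>a\<le>k. \<mu> a * \<mu> (k - a)) =
          (\<Sum>a\<le>k. (if a = 0 then \<sigma> * \<mu> k else 0) + (if a = k then \<sigma> * \<mu> k else 0))"
        by (rule sum.cong) (use False that in \<open>auto simp: \<mu>\<close>)
      then show ?thesis
        using False that by (simp add: sum.distrib \<mu>)
    qed
    have "(\<Sum>i<n + 2. \<Sum>j<n + 2. \<omega> i * \<omega> j * dd2 f (real i * s) (real j * s)) =
        (\<Sum>m\<le>degree f. coeff f m * (if m < 2 then 0 else \<Sum>a\<le>m - 2. \<mu> a * \<mu> (m - 2 - a)))"
      unfolding dd2_moments[where \<omega> = \<omega> and M = "n + 2" and q = f and x = "\<lambda>i. real i * s"] pair_coeffs_def \<mu>_def ..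
    also have "\<dots> = (\<Sum>m\<le>degree f. (if m = 2 then coeff f 2 * \<sigma>\<^sup>2 else 0)
        + (if m = degree f then c * (2 * \<beta> * \<sigma>) else 0))"
    proof (rule sum.cong[OF refl])
      fix m assume "m \<in> {..degree f}"
      then consider "m < 2" | k where "m = Suc (Suc k)" "k \<le> n"
        using n(1) by (metis Suc_le_mono atMost_iff less_2_cases_iff not0_implies_Suc One_nat_def)
      then show "coeff f m * (if m < 2 then 0 else \<Sum>a\<le>m - 2. \<mu> a * \<mu> (m - 2 - a)) =
          (if m = 2 then coeff f 2 * \<sigma>\<^sup>2 else 0) + (if m = degree f then c * (2 * \<beta> * \<sigma>) else 0)"
      proof cases
        case 1
        then show ?thesis using n by simp
      next
        case (2 k)
        then have "(\<Sum>a\<le>m - 2. \<mu> a * \<mu> (m - 2 - a)) =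
            (if k = 0 then \<sigma>\<^sup>2 else if k = n then 2 * \<beta> * \<sigma> else 0)"
          using weight[of k] by simp
        then show ?thesis
          using 2 n by (auto simp: c_def numeral_2_eq_2)
      qed
    qed
    also have "\<dots> = coeff f 2 * \<sigma>\<^sup>2 + 2 * (c * \<beta>) * \<sigma>"
      using n by (simp add: sum.distrib)
    finally show ?thesis
      using psd'[of \<omega>] by simp
  qed
  \<comment> \<open>A parabola through the origin with nonzero slope there takes negative values.\<close>
  define w where "w = c * \<beta>"
  define \<theta> where "\<theta> = 1 / (1 + \<bar>coeff f 2\<bar>)"
  have \<theta>: "\<theta> > 0" "\<bar>coeff f 2\<bar> * \<theta> < 1"
    by (auto simp: \<theta>_def divide_less_eq)
  have "coeff f 2 * (- w * \<theta>)\<^sup>2 + 2 * w * (- w * \<theta>) = w\<^sup>2 * \<theta> * (coeff f 2 * \<theta> - 2)"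
    by (simp add: power2_eq_square algebra_simps)
  moreover have "w\<^sup>2 * \<theta> > 0"
    using c \<theta> by (simp add: w_def)
  moreover have "coeff f 2 * \<theta> - 2 < 0"
    using \<theta> mult_right_mono[OF abs_ge_self[of "coeff f 2"], of \<theta>] by linarith
  ultimately have "coeff f 2 * (- w * \<theta>)\<^sup>2 + 2 * w * (- w * \<theta>) < 0"
    by (simp add: mult_pos_neg)
  with parabola[of "- w * \<theta>"] show False
    by (simp add: w_def)
qed

lemma coeff_2_nonneg_if_kernel_psd:
  assumes psd: "\<And>\<omega>. 0 \<le> (\<Sum>i<0 + 2. \<Sum>j<0 + 2. \<omega> i * \<omega> j * dd2 f (real i * s) (real j * s))"
  shows "coeff f 2 \<ge> 0"
proof -
  obtain a b S where f: "f = pCons a (pCons b S)"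
    by (metis pCons_cases)
  have "0 \<le> dd2 f 0 0"
    using psd[of "\<lambda>i. if i = 0 then 1 else 0"] by (simp add: numeral_2_eq_2)
  then show ?thesis
    unfolding f dd2_zero_pCons by (simp add: poly_0_coeff_0 numeral_2_eq_2)
qed

section \<open>The decomposition\<close>

lemma at_fx_degree_le:
  assumes "degree q \<le> n"
  shows "at_fx q = (\<Sum>m\<le>n. Poly_Mapping.single (x_power m) (coeff q m))"
  unfolding at_fx_eq
  by (rule sum.mono_neutral_left) (use assms in \<open>auto simp: coeff_eq_0\<close>)

lemma fstar_add: "fstar (p + q) = fstar p + fstar q"
  by (rule poly_mapping_eqI) (simp add: lookup_fstar lookup_add)

lemma fstar_diff: "fstar (p - q) = fstar p - fstar q"
  by (rule poly_mapping_eqI) (simp add: lookup_fstar lookup_minus)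

lemma quadratic_pencil_decomposition:
  assumes r: "degree r \<le> 1" "poly r 0 = 1"
    and f: "degree f \<le> 2" "poly f 0 = 0" "coeff f 2 \<ge> 0"
  shows "\<exists>(l :: free_poly) (m :: nat) (s :: nat \<Rightarrow> free_poly).
            symmetric_poly l \<and> affine_linear_in_x l \<and>
            (\<forall>j \<in> {1..m}. linear_in_x (s j) \<and> independent_of_a (s j)) \<and>
            pencil r f = l - (\<Sum>j = 1..m. fstar (s j) * s j)"
proof -
  define r1 where "r1 = coeff r 1"
  define f1 where "f1 = coeff f 1"
  define c where "c = sqrt (2 * coeff f 2)"
  have c: "c * c = 2 * coeff f 2"
    using f(3) by (simp add: c_def)
  define l where "l = Poly_Mapping.single (Word [LetA]) 2 + Poly_Mapping.single (Word [LetX, LetA]) r1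
    + Poly_Mapping.single (Word [LetA, LetX]) r1 - Poly_Mapping.single (Word [LetX]) (2 * f1)"
  define s where "s = Poly_Mapping.single (Word [LetX]) c"
  have at_r: "at_fx r = Poly_Mapping.single (Word []) 1 + Poly_Mapping.single (Word [LetX]) r1"
    using r(2) by (simp add: at_fx_degree_le[OF r(1)] r1_def poly_0_coeff_0)
  have at_f: "at_fx f = Poly_Mapping.single (Word [LetX]) f1 + Poly_Mapping.single (Word [LetX, LetX]) (coeff f 2)"
    using f(2) by (simp add: at_fx_degree_le[OF f(1)] f1_def poly_0_coeff_0 numeral_2_eq_2)
  have "pencil r f = l - fstar s * s"
    unfolding pencil_def at_r at_f l_def s_def fa_def fconst_def
    by (simp add: distrib_left distrib_right mult_single plus_word_def zero_word_def fstar_single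
        rev_word_def c single_add[symmetric] algebra_simps)
  moreover have "symmetric_poly l"
    unfolding symmetric_poly_def l_def
    by (simp add: fstar_add fstar_diff fstar_single rev_word_def algebra_simps)
  moreover have "affine_linear_in_x l"
    unfolding affine_linear_in_x_def l_def
    by (auto simp: in_keys_iff lookup_add lookup_minus lookup_single when_def x_deg_def split: if_splits)
  moreover have "linear_in_x s" "independent_of_a s"
    by (auto simp: s_def linear_in_x_def independent_of_a_def x_deg_def)
  ultimately show ?thesis
    by (intro exI[of _ l] exI[of _ 1] exI[of _ "\<lambda>_. s"]) simp
qed

theorem theorem1p3:
  fixes r f :: "real poly" and k d :: nat and p :: free_poly
  assumes deg_r: "degree r = k" and deg_f: "degree f = d"
    and p_eq: "p = at_fx r * fa + fa * at_fx r - fconst 2 * at_fx f"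
    and r_0: "poly r 0 = 1" and f_0: "poly f 0 = 0"
    and nonconst: "\<nexists>c :: real.
      Fraction_Field.Fract f 1 * inverse (Fraction_Field.Fract r 1) = Fraction_Field.Fract [:c:] 1"
    and conv: "\<exists>\<epsilon>>0. \<forall>n>0. \<forall>A \<in> sym_mats n.
      convex_mats {X \<in> sym_mats n. pos_def (eval_free n A X p) \<and> op_norm X < \<epsilon>}"
  shows "(\<exists>(l :: free_poly) (m :: nat) (s :: nat \<Rightarrow> free_poly).
            symmetric_poly l \<and> affine_linear_in_x l \<and>
            (\<forall>j \<in> {1..m}. linear_in_x (s j) \<and> independent_of_a (s j)) \<and>
            p = l - (\<Sum>j = 1..m. fstar (s j) * s j))
         \<and> d \<le> 2"
proof -
  have p: "p = pencil r f"
    by (simp add: p_eq pencil_def)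
  obtain \<epsilon> where \<epsilon>: "\<epsilon> > 0" and conv': "matrix_convex r f \<epsilon>"
    using conv unfolding matrix_convex_def p by blast
  have deg_r_le: "degree r \<le> 1"
    by (rule degree_r_le_1[OF conv' \<epsilon> r_0 f_0])
  obtain r1 where r: "r = [:1, r1:]"
  proof -
    obtain a q where q: "r = pCons a q"
      by (rule pCons_cases)
    then have "degree q = 0"
      using deg_r_le by (cases "q = 0") auto
    then obtain b where "q = [:b:]"
      by (rule degree_eq_zeroE)
    then show thesis using q r_0 that by simp
  qed
  have psd: "\<exists>s>0. \<forall>\<omega>. 0 \<le> (\<Sum>i<n + 2. \<Sum>j<n + 2. \<omega> i * \<omega> j * dd2 f (real i * s) (real j * s))" for n
    using curvature_kernel_psd[OF conv'[unfolded r] \<epsilon> f_0, of n] by blast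
  have deg_f_le: "degree f \<le> 2"
    by (rule degree_le_2_if_kernels_psd[OF psd])
  have "coeff f 2 \<ge> 0"
    using psd[of 0] coeff_2_nonneg_if_kernel_psd[of f] by blast
  from quadratic_pencil_decomposition[OF deg_r_le r_0 deg_f_le f_0 this] show ?thesis
    using deg_f_le deg_f unfolding p by blast
qed

end
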